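(* Let $H_1$ be the digraph on vertices $a,b,c,d$ with arc set $\{(a,b),(b,a),(b,c),(c,b),(c,d),(d,a)\}$, and let $H_2$ be the digraph on vertices $a,b,c,d$ with arc set $\{(a,b),(b,a),(b,c),(c,b),(c,d),(a,d)\}$. Then $\mathrm{mader}_{\overrightarrow{\chi}}(H_1)=\mathrm{mader}_{\overrightarrow{\chi}}(H_2)=4$.
   Context: An acyclic $k$-coloring of a digraph $D$ is a map $c:V(D)\to\{1,\ldots,k\}$ whose color classes each induce a subdigraph with no directed cycle; $\overrightarrow{\chi}(D)$ is the least such $k$. A subdivision of a digraph $H$ is obtained by replacing each arc $(u,v)$ by a directed $u$–$v$ path, the paths internally vertex-disjoint from each other and from $V(H)$. $\mathrm{mader}_{\overrightarrow{\chi}}(H)$ is the smallest integer $m$ such that every digraph $D$ with $\overrightarrow{\chi}(D)\ge m$ contains a subdivision of $H$. Thus $H_1$ and $H_2$ are subdigraphs of the biorientation of the 4-cycle $abcd$ consisting of two digons sharing the vertex $b$ together with, respectively, a directed path $c\to d\to a$ (for $H_1$) or two arcs entering $d$ (for $H_2$). *)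

theory Defs
  imports
    "Graph_Theory.Graph_Theory"
    "HOL-Library.Extended_Nat"
    "HOL-Library.Infinite_Typeclass"
begin

text \<open>
  Digraphs are those of the locale \<open>pair_digraph\<close>: finite, without loops and without parallel
  arcs, but possibly with digons (which are directed cycles of length 2).
\<close>

definition acyclic_coloring :: "'v pair_pre_digraph \<Rightarrow> nat \<Rightarrow> ('v \<Rightarrow> nat) \<Rightarrow> bool" where
  "acyclic_coloring D k c \<longleftrightarrow>
     c ` pverts D \<subseteq> {1..k} \<and>
     (\<forall>i\<in>{1..k}. \<nexists>p. pre_digraph.cycle (with_proj D \<restriction> {v \<in> pverts D. c v = i}) p)"

definition dichromatic_number :: "'v pair_pre_digraph \<Rightarrow> nat" where
  "dichromatic_number D = (LEAST k. \<exists>c. acyclic_coloring D k c)"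

text \<open>
  \<open>f\<close> embeds the vertices of \<open>H\<close> as branch vertices of \<open>S\<close> (so that \<open>S\<close> is a subdivision of \<open>H\<close>
  up to renaming of vertices), and \<open>P e\<close> is the path, as a list of arcs, that replaces the
  arc \<open>e\<close>. It may consist of a single arc. The constant \<open>subdivision\<close> of the library is about
  subdividing both arcs of a digon of a symmetric digraph simultaneously, hence not applicable.
\<close>

definition subdivision_of :: "'h pair_pre_digraph \<Rightarrow> 'v pair_pre_digraph \<Rightarrow> bool" where
  "subdivision_of H S \<longleftrightarrow>
     (\<exists>(f :: 'h \<Rightarrow> 'v) (P :: 'h \<times> 'h \<Rightarrow> ('v \<times> 'v) awalk).
        let inner = (\<lambda>e. set (pre_digraph.inner_verts (with_proj S) (P e))) in
        inj_on f (pverts H) \<and>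
        (\<forall>(u, v)\<in>parcs H. pre_digraph.apath (with_proj S) (f u) (P (u, v)) (f v)) \<and>
        (\<forall>e\<in>parcs H. inner e \<inter> f ` pverts H = {}) \<and>
        (\<forall>e\<in>parcs H. \<forall>e'\<in>parcs H. e \<noteq> e' \<longrightarrow> inner e \<inter> inner e' = {}) \<and>
        pverts S = f ` pverts H \<union> (\<Union>e\<in>parcs H. inner e) \<and>
        parcs S = (\<Union>e\<in>parcs H. set (P e)))"

definition contains_subdivision :: "'v pair_pre_digraph \<Rightarrow> 'h pair_pre_digraph \<Rightarrow> bool" where
  "contains_subdivision D H \<longleftrightarrow>
     (\<exists>S. subgraph (with_proj S) (with_proj D) \<and> subdivision_of H S)"

text \<open>
  The host digraphs \<open>D\<close> have their vertices in the type \<open>'v\<close>. Every finite digraph has a copy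
  with vertices in any given infinite type, so all infinite \<open>'v\<close> yield the same number.
  The infimum is the least such \<open>m\<close>, and it is \<open>\<infinity>\<close> if there is none.
\<close>

definition mader :: "'v itself \<Rightarrow> 'h pair_pre_digraph \<Rightarrow> enat" where
  "mader (_ :: 'v itself) H =
     (INF m\<in>{m. \<forall>D :: 'v pair_pre_digraph.
                  pair_digraph D \<longrightarrow> m \<le> dichromatic_number D \<longrightarrow> contains_subdivision D H}.
        enat m)"

end

theory Submission
  imports Defs "HOL-Library.Multiset"
begin

text \<open>
  Upper bound: take a minimal digraph that is not 3-colourable. If \<open>D - v\<close> is strong, a
  3-colouring of \<open>D - v\<close> yields three directed cycles that share only \<open>v\<close>. For \<open>H1\<close>,
  rerouting these cycles along the arcs between them already gives a subdivision in which \<open>v\<close>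
  plays the role of \<open>b\<close>. For \<open>H2\<close>, the absence of such a subdivision forces \<open>D - v\<close> into a
  cyclic arrangement of three parts in which all paths traversing a part go through one vertex.
  Colourings of smaller digraphs can then be recoloured so that they combine to a 3-colouring
  of \<open>D\<close>.

  If \<open>D - v\<close> is not strong, one side is contracted into \<open>v\<close>. A subdivision lifts from the
  contraction unless \<open>b\<close> is mapped to \<open>v\<close>. The induction therefore proves that there is a
  subdivision whose vertex \<open>b\<close> avoids any prescribed root \<open>r\<close>.

  Lower bound: the complete digraph on three vertices has dichromatic number 3, but too few vertices.
\<close>

text \<open>\<open>b\<close> is the only vertex of \<open>H1\<close> and \<open>H2\<close> with four
  incident arcs; at the other branch vertices the paths at most fork or join. Hence only
  \<open>b\<close> can spoil a lift: if it is the contracted vertex, its arcs may attach to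
  different vertices of the contracted side.

  The forbidden root makes the induction close up. A contraction is treated with its own vertex
  \<open>v\<close> as the root, so \<open>b\<close> is found in the uncontracted part
  \<open>R\<close>, and \<open>b\<close> differs from \<open>r\<close> as soon as \<open>R\<close>
  avoids \<open>r\<close>. Each use of the induction therefore needs two disjoint candidates for
  \<open>R\<close>, one of which misses \<open>r\<close>: the two sides of a cut, or two parts of
  the cyclic arrangement.

  The recolouring for \<open>H2\<close> is a count of colours. Two colourings are glued so that they
  agree at \<open>v\<close>. A bad cycle in the colour of \<open>v\<close> would show up in the
  contraction already. A bad cycle in another colour has to traverse two disjoint parts, each
  through its cut vertex, and with two colours left besides that of \<open>v\<close> the cut
  vertices can be made to disagree.\<close>

section \<open>Reachability inside a vertex set\<close>

definition reach :: "('a \<times> 'a) set \<Rightarrow> 'a set \<Rightarrow> 'a \<Rightarrow> 'a \<Rightarrow> bool" where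
  "reach E S x y \<longleftrightarrow> x \<in> S \<and> y \<in> S \<and> (x, y) \<in> (Restr E S)\<^sup>*"

abbreviation walk :: "('a \<times> 'a) set \<Rightarrow> 'a list \<Rightarrow> bool" where
  "walk E \<equiv> successively (\<lambda>x y. (x, y) \<in> E)"

lemma reach_refl: "x \<in> S \<Longrightarrow> reach E S x x"
  by (simp add: reach_def)

lemma reach_in: "reach E S x y \<Longrightarrow> x \<in> S" "reach E S x y \<Longrightarrow> y \<in> S"
  by (simp_all add: reach_def)

lemma reach_trans: "reach E S x y \<Longrightarrow> reach E S y z \<Longrightarrow> reach E S x z"
  by (auto simp: reach_def)

lemma reach_step: "(x, y) \<in> E \<Longrightarrow> x \<in> S \<Longrightarrow> y \<in> S \<Longrightarrow> reach E S x y"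
  by (auto simp: reach_def)

lemma reach_mono: "reach E S x y \<Longrightarrow> E \<subseteq> E' \<Longrightarrow> S \<subseteq> S' \<Longrightarrow> reach E' S' x y"
  unfolding reach_def by (meson Int_mono Sigma_mono rtrancl_mono subsetD)

lemma reach_monoS: "reach E S x y \<Longrightarrow> S \<subseteq> S' \<Longrightarrow> reach E S' x y"
  by (rule reach_mono) auto

lemma reach_snoc: "reach E S x y \<Longrightarrow> (y, z) \<in> E \<Longrightarrow> z \<in> S \<Longrightarrow> reach E S x z"
  by (meson reach_in(2) reach_step reach_trans)

lemma reach_cons: "(x, y) \<in> E \<Longrightarrow> reach E S y z \<Longrightarrow> x \<in> S \<Longrightarrow> reach E S x z"
  by (meson reach_in(1) reach_step reach_trans)

lemma reach_induct [consumes 1, case_names refl step]: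
  assumes "reach E S x y"
    and "x \<in> S \<Longrightarrow> P x"
    and "\<And>y z. reach E S x y \<Longrightarrow> P y \<Longrightarrow> (y, z) \<in> E \<Longrightarrow> y \<in> S \<Longrightarrow> z \<in> S \<Longrightarrow> P z"
  shows "P y"
proof -
  have x: "x \<in> S" and "(x, y) \<in> (Restr E S)\<^sup>*"
    using assms(1) by (auto simp: reach_def)
  from this(2) show ?thesis
  proof (induction rule: rtrancl_induct)
    case base
    then show ?case using assms(2) x by blast
  next
    case (step y z)
    then show ?case using assms(3)[of y z] x by (auto simp: reach_def)
  qed
qed

lemma reach_converse: "reach (E\<inverse>) S x y \<longleftrightarrow> reach E S y x"
proof -
  have "Restr (E\<inverse>) S = (Restr E S)\<inverse>" by auto
  then show ?thesis by (auto simp: reach_def rtrancl_converse)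
qed

lemma reach_converse_induct [consumes 1, case_names refl step]:
  assumes "reach E S x y"
    and "y \<in> S \<Longrightarrow> P y"
    and "\<And>x z. (x, z) \<in> E \<Longrightarrow> reach E S z y \<Longrightarrow> P z \<Longrightarrow> x \<in> S \<Longrightarrow> z \<in> S \<Longrightarrow> P x"
  shows "P x"
proof -
  have "reach (E\<inverse>) S y x" using assms(1) by (simp add: reach_converse)
  then show ?thesis
    by (induction rule: reach_induct) (use assms(2,3) in \<open>auto simp: reach_converse\<close>)
qed

text \<open>Cutting at the first arc that leaves \<open>T\<close> confines the part before it; the
  part after it may come back to \<open>T\<close>.\<close>

lemma reach_exit:
  assumes "reach E S x y" "x \<in> T" "y \<notin> T"
  obtains u w where "reach E (S \<inter> T) x u" "(u, w) \<in> E" "w \<in> S - T" "reach E S w y"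
proof -
  have "x \<in> T \<longrightarrow> (\<exists>u w. reach E (S \<inter> T) x u \<and> (u, w) \<in> E \<and> w \<in> S - T \<and> reach E S w y)"
    using assms(1)
  proof (induction rule: reach_converse_induct)
    case refl
    then show ?case using assms(3) by blast
  next
    case (step x z)
    show ?case
    proof (intro impI)
      assume x: "x \<in> T"
      show "\<exists>u w. reach E (S \<inter> T) x u \<and> (u, w) \<in> E \<and> w \<in> S - T \<and> reach E S w y"
      proof (cases "z \<in> T")
        case True
        then obtain u w where "reach E (S \<inter> T) z u" "(u, w) \<in> E" "w \<in> S - T" "reach E S w y"
          using step by blast
        then show ?thesis using step x reach_cons[of x z E "S \<inter> T" u] by blast
      next
        case False
        then show ?thesis using step x reach_refl[of x "S \<inter> T" E] by blast
      qed
    qed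
  qed
  then show ?thesis using that assms(2) by blast
qed

text \<open>Reversal of \<open>reach_exit\<close>: the cut is at the last entry into
  \<open>T\<close>, so here the final part is confined.\<close>

lemma reach_entry:
  assumes "reach E S x y" "x \<notin> T" "y \<in> T"
  obtains u w where "reach E S x u" "u \<in> S - T" "(u, w) \<in> E" "reach E (S \<inter> T) w y"
proof -
  have "reach (E\<inverse>) S y x" using assms(1) by (simp add: reach_converse)
  from reach_exit[OF this assms(3,2)] show ?thesis
    using that by (auto simp: reach_converse)
qed

lemma reach_split:
  assumes "reach E S x y"
  shows "reach E (S \<inter> T) x y \<or> (\<exists>z\<in>S - T. reach E S x z \<and> reach E S z y)"
proof (cases "x \<in> T")
  case False
  then show ?thesis using assms reach_in[OF assms] reach_refl by fast
next
  case True
  have "reach E (S \<inter> T) x y \<or> (\<exists>z\<in>S - T. reach E S x z \<and> reach E S z y)"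
    using assms
  proof (induction rule: reach_induct)
    case refl
    then show ?case using True by (simp add: reach_refl)
  next
    case (step y z)
    show ?case
    proof (cases "z \<in> T")
      case True
      then show ?thesis using step reach_snoc[of E "S \<inter> T" x y z] reach_snoc[of E S _ y z] by blast
    next
      case False
      then show ?thesis using step reach_snoc[of E S x y z] reach_refl[of z S E] by blast
    qed
  qed
  then show ?thesis .
qed

subsection \<open>Paths as lists\<close>

lemma walk_reach:
  assumes "walk E (us @ x # vs)" "y \<in> set (x # vs)" "set (x # vs) \<subseteq> S"
  shows "reach E S x y"
proof -
  have "walk E (x # vs)" using assms(1) by (auto simp: successively_append_iff)
  then show ?thesis using assms(2,3)
  proof (induction vs arbitrary: x)
    case Nil
    then show ?case by (simp add: reach_refl)
  next
    case (Cons w vs)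
    show ?case
    proof (cases "y = x")
      case True
      then show ?thesis using Cons.prems by (simp add: reach_refl)
    next
      case False
      then have "reach E S w y" using Cons by auto
      then show ?thesis using Cons.prems reach_cons[of x w E S y] by auto
    qed
  qed
qed

lemma reach_walk:
  assumes "reach E S x y"
  obtains xs where "walk E (x # xs)" "distinct (x # xs)" "set (x # xs) \<subseteq> S" "last (x # xs) = y"
proof -
  have "\<exists>xs. walk E (x # xs) \<and> distinct (x # xs) \<and> set (x # xs) \<subseteq> S \<and> last (x # xs) = y"
    using assms
  proof (induction rule: reach_converse_induct)
    case refl
    then show ?case by (intro exI[of _ "[]"]) auto
  next
    case (step x z)
    then obtain xs where xs: "walk E (z # xs)" "distinct (z # xs)" "set (z # xs) \<subseteq> S" "last (z # xs) = y"
      by blast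
    show ?case
    proof (cases "x \<in> set (z # xs)")
      case False
      then show ?thesis using xs step by (intro exI[of _ "z # xs"]) auto
    next
      case True
      then obtain us vs where "z # xs = us @ x # vs" by (meson split_list)
      then show ?thesis using xs
        by (intro exI[of _ vs]) (auto simp: successively_append_iff)
    qed
  qed
  then show ?thesis using that by blast
qed

lemma walk_reach_last:
  assumes "walk E (us @ vs)" "x \<in> set us" "set us \<subseteq> S"
  shows "reach E S x (last us)"
proof -
  obtain a b where ab: "us = a @ x # b" using assms(2) by (meson split_list)
  then have "walk E (a @ x # (b @ vs))" using assms(1) by simp
  then have "walk E (a @ x # b)" by (metis append_Cons append_assoc successively_append_iff)
  from walk_reach[OF this] show ?thesis using ab assms(3) by auto
qed

text \<open>Turns two reachability facts with a common source into disjoint paths in the shape of a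
  Y. The centre \<open>a\<close> becomes a branch vertex of degree three.\<close>

lemma reach_fork:
  assumes "reach E S s t" "reach E S s q"
  obtains ps a ts qs where "walk E (ps @ a # ts)" "walk E (a # qs)" "distinct (ps @ a # ts @ qs)"
    "set (ps @ a # ts @ qs) \<subseteq> S" "hd (ps @ [a]) = s" "last (a # ts) = t" "last (a # qs) = q"
proof -
  obtain L where L: "walk E (s # L)" "distinct (s # L)" "set (s # L) \<subseteq> S" "last (s # L) = t"
    using reach_walk[OF assms(1)] .
  obtain Q where Q: "walk E (s # Q)" "distinct (s # Q)" "set (s # Q) \<subseteq> S" "last (s # Q) = q"
    using reach_walk[OF assms(2)] .
  \<comment> \<open>The centre is the last vertex of the second path that lies on the first one;
    what follows it on the second path is disjoint from the first.\<close>
  have "\<exists>x\<in>set (s # Q). x \<in> set (s # L)" by simp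
  then obtain u a qs where a: "s # Q = u @ a # qs" "a \<in> set (s # L)" "\<forall>z\<in>set qs. z \<notin> set (s # L)"
    using split_list_last_prop[of "s # Q" "\<lambda>x. x \<in> set (s # L)"] by blast
  obtain ps ts where ps: "s # L = ps @ a # ts" using a(2) by (meson split_list)
  show ?thesis
  proof (rule that[of ps a ts qs])
    show "walk E (ps @ a # ts)" using L ps by simp
    show "walk E (a # qs)" using Q(1) a(1) by (auto simp: successively_append_iff)
    have "distinct (ps @ a # ts)" using L ps by metis
    moreover have "distinct (a # qs)" using Q a by (metis distinct_append)
    moreover have "set qs \<inter> set (ps @ a # ts) = {}" using a(3) ps by auto
    ultimately show "distinct (ps @ a # ts @ qs)" by auto
    have "set (ps @ a # ts) \<subseteq> S" using L ps by metis
    moreover have "set (a # qs) \<subseteq> S" using Q(3) a(1) by (metis Un_subset_iff set_append)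
    ultimately show "set (ps @ a # ts @ qs) \<subseteq> S" by auto
    show "hd (ps @ [a]) = s" using ps by (cases ps) auto
    show "last (a # ts) = t" using L ps by (metis last_appendR list.distinct(1))
    show "last (a # qs) = q" using Q a by (metis last_appendR list.distinct(1))
  qed
qed

lemma reach_join:
  assumes "reach E S t s" "reach E S q s"
  obtains ps a ts qs where "walk E (ts @ a # ps)" "walk E (qs @ [a])" "distinct (ts @ a # ps @ qs)"
    "set (ts @ a # ps @ qs) \<subseteq> S" "last (a # ps) = s" "hd (ts @ [a]) = t" "hd (qs @ [a]) = q"
proof -
  have "reach (E\<inverse>) S s t" "reach (E\<inverse>) S s q" using assms by (simp_all add: reach_converse)
  then obtain ps a ts qs where *: "walk (E\<inverse>) (ps @ a # ts)" "walk (E\<inverse>) (a # qs)" "distinct (ps @ a # ts @ qs)"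
    "set (ps @ a # ts @ qs) \<subseteq> S" "hd (ps @ [a]) = s" "last (a # ts) = t" "last (a # qs) = q"
    by (rule reach_fork)
  have w: "walk E (rev xs) \<longleftrightarrow> walk (E\<inverse>) xs" for xs
    by (simp add: successively_rev)
  show ?thesis
  proof (rule that[of "rev ts" a "rev ps" "rev qs"])
    show "walk E (rev ts @ a # rev ps)" using w[of "ps @ a # ts"] *(1) by simp
    show "walk E (rev qs @ [a])" using w[of "a # qs"] *(2) by simp
    show "distinct (rev ts @ a # rev ps @ rev qs)" using *(3) by auto
    show "set (rev ts @ a # rev ps @ rev qs) \<subseteq> S" using *(4) by auto
    show "last (a # rev ps) = s" using *(5) by (cases ps) auto
    show "hd (rev ts @ [a]) = t" using *(6) by (cases ts rule: rev_cases) auto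
    show "hd (rev qs @ [a]) = q" using *(7) by (cases qs rule: rev_cases) auto
  qed
qed

subsection \<open>Colourings\<close>

text \<open>Acyclicity of this one relation says that all colour classes are acyclic at
  once.\<close>

definition mono_arcs :: "('a \<Rightarrow> nat) \<Rightarrow> ('a \<times> 'a) set \<Rightarrow> ('a \<times> 'a) set" where
  "mono_arcs c E = {(x, y) \<in> E. c x = c y}"

definition colorable :: "('a \<times> 'a) set \<Rightarrow> bool" where
  "colorable E \<longleftrightarrow> (\<exists>c :: 'a \<Rightarrow> nat. range c \<subseteq> {..<3} \<and> acyclic (mono_arcs c E))"

lemma colorableI: "range c \<subseteq> {..<3} \<Longrightarrow> acyclic (mono_arcs c E) \<Longrightarrow> colorable E"
  unfolding colorable_def by (intro exI[of _ c] conjI)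

lemma colorableE:
  assumes "colorable E"
  obtains c :: "'a \<Rightarrow> nat" where "range c \<subseteq> {..<3}" "acyclic (mono_arcs c E)"
proof -
  obtain c :: "'a \<Rightarrow> nat" where c: "range c \<subseteq> {..<3} \<and> acyclic (mono_arcs c E)"
    using assms unfolding colorable_def by (rule exE)
  show thesis by (rule that[OF conjunct1[OF c] conjunct2[OF c]])
qed

definition strong :: "('a \<times> 'a) set \<Rightarrow> 'a set \<Rightarrow> bool" where
  "strong E S \<longleftrightarrow> (\<forall>x\<in>S. \<forall>y\<in>S. reach E S x y)"

text \<open>
  All vertices outside of \<open>R\<close> are identified with \<open>v\<close>.
\<close>

definition contract :: "('a \<times> 'a) set \<Rightarrow> 'a set \<Rightarrow> 'a \<Rightarrow> ('a \<times> 'a) set" where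
  "contract E R v = Restr E (insert v R)
     \<union> {(u, v) | u m. u \<in> R \<and> m \<notin> insert v R \<and> (u, m) \<in> E}
     \<union> {(v, u) | u m. u \<in> R \<and> m \<notin> insert v R \<and> (m, u) \<in> E}"

lemma mono_rtrancl: "(x, y) \<in> (mono_arcs c E)\<^sup>* \<Longrightarrow> c x = c y \<and> reach E {z. c z = c x} x y"
proof (induction rule: rtrancl_induct)
  case base
  then show ?case by (simp add: reach_refl)
next
  case (step y z)
  then show ?case by (auto simp: mono_arcs_def intro: reach_snoc)
qed

lemma reach_rtrancl:
  assumes "reach E S x y" "\<And>z. z \<in> S \<Longrightarrow> c z = i"
  shows "(x, y) \<in> (mono_arcs c E)\<^sup>*"
  using assms(1)
proof (induction rule: reach_induct)
  case (step y z)
  have "c y = c z" using assms(2) step by metis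
  then have "(y, z) \<in> mono_arcs c E" using step by (simp add: mono_arcs_def)
  then show ?case using step.IH by (meson rtrancl.rtrancl_into_rtrancl)
qed simp

lemma acyclic_monoD:
  assumes "acyclic (mono_arcs c E)" "(x, y) \<in> E" "reach E S y x" "\<And>z. z \<in> S \<Longrightarrow> c z = i"
  shows False
proof -
  have "c x = c y" using assms(3,4) reach_in by metis
  then have "(x, y) \<in> mono_arcs c E" using assms by (simp add: mono_arcs_def)
  then have "(x, x) \<in> (mono_arcs c E)\<^sup>+" 
    using reach_rtrancl[OF assms(3,4)] by (meson rtrancl_into_trancl2)
  then show False using assms(1) by (simp add: acyclic_def)
qed

lemma not_acyclic_mono:
  assumes "\<not> acyclic (mono_arcs c E)"
  obtains x y where "(x, y) \<in> E" "c x = c y" "reach E {z. c z = c x} y x"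
proof -
  obtain x where "(x, x) \<in> (mono_arcs c E)\<^sup>+" using assms by (auto simp: acyclic_def)
  then obtain y where "(x, y) \<in> mono_arcs c E" "(y, x) \<in> (mono_arcs c E)\<^sup>*" by (meson tranclD)
  then show ?thesis using that mono_rtrancl[of y x c E] by (auto simp: mono_arcs_def)
qed

lemma reach_Restr: "reach E S x y \<Longrightarrow> S \<subseteq> T \<Longrightarrow> reach (Restr E T) S x y"
proof (induction rule: reach_induct)
  case refl
  then show ?case by (simp add: reach_refl)
next
  case (step y z)
  then show ?case by (intro reach_snoc[of "Restr E T" S x y z]) auto
qed

text \<open>Gluing two colourings along \<open>v\<close>. A monochromatic cycle that meets
  \<open>R\<close> and leaves \<open>insert v R\<close> contains a segment through \<open>R\<close>.
  In the colour of \<open>v\<close> that segment closes up at the contracted vertex; in another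
  colour the cycle avoids \<open>v\<close>, hence traverses both \<open>R\<close> and
  \<open>M\<close>, which \<open>block\<close> excludes.\<close>

lemma acyclic_mono_combine:
  fixes c1 c2 :: "'a \<Rightarrow> nat"
  assumes E: "E \<subseteq> insert v (R \<union> M) \<times> insert v (R \<union> M)" and RM: "R \<inter> M = {}" "v \<notin> R" "v \<notin> M"
    and c1: "acyclic (mono_arcs c1 (contract E R v))"
    and c2: "acyclic (mono_arcs c2 (Restr E (insert v M)))"
    and v: "c1 v = c2 v"
    and block: "\<And>i a e z b a' e' z' b'. i \<noteq> c1 v \<Longrightarrow>
       a \<in> M \<Longrightarrow> (a, e) \<in> E \<Longrightarrow> reach E (R \<inter> {z. c1 z = i}) e z \<Longrightarrow> (z, b) \<in> E \<Longrightarrow> b \<in> M \<Longrightarrow>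
       a' \<in> R \<Longrightarrow> (a', e') \<in> E \<Longrightarrow> reach E (M \<inter> {z. c2 z = i}) e' z' \<Longrightarrow> (z', b') \<in> E \<Longrightarrow> b' \<in> R \<Longrightarrow> False"
  shows "acyclic (mono_arcs (\<lambda>x. if x \<in> insert v R then c1 x else c2 x) E)"
proof (rule ccontr)
  define c where "c = (\<lambda>x. if x \<in> insert v R then c1 x else c2 x)"
  have cR: "c x = c1 x" if "x \<in> insert v R" for x using that by (simp add: c_def)
  have cM: "c x = c2 x" if "x \<in> insert v M" for x using that RM v by (auto simp: c_def)
  have R_contr: "Restr E (insert v R) \<subseteq> contract E R v" by (auto simp: contract_def)
  assume "\<not> ?thesis"
  then have "\<not> acyclic (mono_arcs c E)" by (simp add: c_def)
  then obtain x y where xy: "(x, y) \<in> E" "c x = c y" "reach E {z. c z = c x} y x"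
    by (rule not_acyclic_mono)
  define i where "i = c x"
  define K where "K = {z. c z = i}"
  have xK: "x \<in> K" "y \<in> K" using xy by (auto simp: K_def i_def)
  have yx: "reach E K y x" using xy by (simp add: K_def i_def)
  \<comment> \<open>A closed monochromatic walk never visits \<open>R\<close>; afterwards it lies in
    \<open>insert v M\<close>, where \<open>c2\<close> excludes it.\<close>
  have noR: False if u: "u \<in> R" and xu: "reach E K x u" and ux: "reach E K u x" for u
  proof -
    have uK: "u \<in> K" using xu reach_in by metis
    have cyc: "\<exists>w. (u, w) \<in> E \<and> reach E K w u"
    proof (cases "u = x")
      case True
      then show ?thesis using xy yx by blast
    next
      case False
      then obtain w where "(u, w) \<in> E" "reach E K w x"
        using reach_exit[OF ux, of "{u}"] 
        by (metis Diff_iff IntD2 reach_in(2) singletonD singletonI)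
      then show ?thesis using xu reach_trans[of E K w x u] by blast
    qed
    then obtain w where w: "(u, w) \<in> E" "reach E K w u" by blast
    consider "reach E (K \<inter> insert v R) w u" | z where "z \<in> K - insert v R" "reach E K w z" "reach E K z u"
      using reach_split[OF w(2), of "insert v R"] by blast
    then show False
    proof cases
      case 1
      have "w \<in> insert v R" using 1 reach_in by fast
      then have uw: "(u, w) \<in> contract E R v" using w u R_contr by blast
      have r: "reach (contract E R v) (K \<inter> insert v R) w u"
        using reach_Restr[OF 1, of "insert v R"] R_contr by (meson Int_lower2 order_refl reach_mono)
      show ?thesis
        by (rule acyclic_monoD[OF c1 uw r, of i]) (use cR in \<open>auto simp: K_def\<close>)
    next
      case 2
      have uz: "reach E K u z" using reach_cons[OF w(1) 2(2) uK] .
      have zR: "z \<notin> R" "z \<notin> insert v R" using 2 by auto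
      obtain q b where q: "reach E (K \<inter> R) u q" "(q, b) \<in> E" "b \<in> K - R" "reach E K b z"
        using reach_exit[OF uz u zR(1)] .
      obtain a e where e: "reach E K z a" "a \<in> K - R" "(a, e) \<in> E" "reach E (K \<inter> R) e u"
        using reach_entry[OF 2(3) zR(1) u] .
      have eq: "reach E (K \<inter> R) e q" using reach_trans[OF e(4) q(1)] .
      have qR: "q \<in> R" "e \<in> R" using eq reach_in by fast+
      have inE: "b \<in> insert v M" "a \<in> insert v M" using E q(2,3) e(2,3) by auto
      show False
      \<comment> \<open>Both neighbours of the segment from \<open>e\<close> to \<open>q\<close> lie
        outside of \<open>R\<close>, so in the contraction they become \<open>v\<close>, and the
        segment is a cycle through \<open>v\<close> there.\<close>
      proof (cases "i = c1 v")
        case True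
        have qv: "(q, v) \<in> contract E R v"
          using q inE RM qR by (cases "b = v") (auto simp: contract_def)
        have ve: "(v, e) \<in> contract E R v"
          using e inE RM qR by (cases "a = v") (auto simp: contract_def)
        have r: "reach (contract E R v) (K \<inter> insert v R) e q"
          by (intro reach_mono[OF reach_Restr[OF eq, of "insert v R"] R_contr]) auto
        then have r: "reach (contract E R v) (K \<inter> insert v R) e v"
          using reach_snoc[OF r qv] True cR by (auto simp: K_def)
        show ?thesis
          by (rule acyclic_monoD[OF c1 ve r, of i]) (use cR in \<open>auto simp: K_def\<close>)
      next
        case False
        have vK: "v \<notin> K" using False cR by (auto simp: K_def)
        then have abM: "a \<in> M" "b \<in> M" using inE q(3) e(2) by auto
        \<comment> \<open>The cycle has to return from \<open>b\<close> to \<open>R\<close>, and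
          without \<open>v\<close> it can do so only straight from \<open>M\<close>: this is the
          second traversal that \<open>block\<close> asks for.\<close>
        have "reach E K b u" using reach_trans[OF q(4)] 2(3) by blast
        moreover have "u \<notin> M" using u RM by blast
        ultimately obtain z' b' where z': "reach E (K \<inter> M) b z'" "(z', b') \<in> E" "b' \<in> K - M"
          using abM(2) by (metis reach_exit)
        have "b' \<in> R" using z' vK E by auto
        moreover have "K \<inter> M = M \<inter> {z. c2 z = i}" using cM by (auto simp: K_def)
        moreover have "K \<inter> R = R \<inter> {z. c1 z = i}" using cR by (auto simp: K_def)
        ultimately show False
          using block[OF False abM(1) e(3), of q b q b z' b'] eq q(2) abM(2) qR z' by metis
      qed
    qed
  qed
  have "reach E (K \<inter> insert v M) y x"
  proof -
    have "\<not> (\<exists>z\<in>K - insert v M. reach E K y z \<and> reach E K z x)"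
    proof
      assume "\<exists>z\<in>K - insert v M. reach E K y z \<and> reach E K z x"
      then obtain z where z: "z \<in> K" "z \<notin> insert v M" "reach E K y z" "reach E K z x" by blast
      have xz: "reach E K x z" using reach_cons[OF xy(1) z(3) xK(1)] .
      have "z \<in> insert v (R \<union> M)"
      proof (cases "z = x")
        case True
        then show ?thesis using xy(1) E by auto
      next
        case False
        then obtain w where "(z, w) \<in> E"
          using reach_exit[OF z(4), of "{z}"] by (metis Int_iff reach_in(2) singletonD singletonI)
        then show ?thesis using E by auto
      qed
      then show False using noR[OF _ xz z(4)] z(2) by blast
    qed
    then show ?thesis using reach_split[OF yx, of "insert v M"] by blast
  qed
  then have r: "reach (Restr E (insert v M)) (K \<inter> insert v M) y x"
    by (rule reach_Restr) auto
  moreover have "(x, y) \<in> Restr E (insert v M)" using xy(1) reach_in[OF r] by blast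
  moreover have "c2 z = i" if "z \<in> K \<inter> insert v M" for z using cM that by (auto simp: K_def)
  ultimately show False
    using acyclic_monoD[OF c2, of x y "K \<inter> insert v M" i] by blast
qed

text \<open>Transposing two colours keeps the monochromatic arcs, so colourings of different
  digraphs can be made to agree at \<open>v\<close>.\<close>

lemma colorable_perm:
  assumes "colorable E" "i < 3"
  obtains c :: "'a \<Rightarrow> nat" where "range c \<subseteq> {..<3}" "acyclic (mono_arcs c E)" "c v = i"
proof -
  obtain c :: "'a \<Rightarrow> nat" where c: "range c \<subseteq> {..<3}" "acyclic (mono_arcs c E)"
    using assms(1) by (rule colorableE)
  let ?f = "Transposition.transpose (c v) i"
  have "inj ?f" by simp
  then have "mono_arcs (?f \<circ> c) E = mono_arcs c E" by (auto simp: mono_arcs_def inj_eq)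
  moreover have "range (?f \<circ> c) \<subseteq> {..<3}"
  proof -
    have "c x < 3" for x using c(1) by blast
    then show ?thesis using assms(2) by (auto simp: Transposition.transpose_def)
  qed
  ultimately show ?thesis using that[of "?f \<circ> c"] c by simp
qed

subsection \<open>Bags\<close>

text \<open>
  Subdivisions with branch vertex \<open>b\<close> are handled through vertex sets in which only
  reachability is required. The branch vertices other than \<open>b\<close> are recovered as the points where
  two paths in a bag fork or join. In this form it is trivial to lift a subdivision from a
  contraction: the bag that contains the contracted vertex absorbs everything outside of \<open>R\<close>.
\<close>

definition out_bag :: "('a \<times> 'a) set \<Rightarrow> 'a \<Rightarrow> 'a set \<Rightarrow> 'a \<Rightarrow> bool" where
  "out_bag E b S q \<longleftrightarrow> (\<exists>s t. (b, s) \<in> E \<and> reach E S s t \<and> (t, b) \<in> E \<and> reach E S s q)"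

text \<open>Reversal of \<open>out_bag\<close>: the bag is entered at \<open>q\<close>, and the
  branch vertex is a join instead of a fork.\<close>

definition in_bag :: "('a \<times> 'a) set \<Rightarrow> 'a \<Rightarrow> 'a set \<Rightarrow> 'a \<Rightarrow> bool" where
  "in_bag E b S q \<longleftrightarrow> (\<exists>s t. (b, s) \<in> E \<and> reach E S s t \<and> (t, b) \<in> E \<and> reach E S q t)"

text \<open>The bags \<open>C\<close> and \<open>A\<close> contain the branch vertices
  \<open>c\<close> and \<open>a\<close>. The path in \<open>D\<close> carries \<open>d\<close>, for
  which any of its vertices can be taken.\<close>

definition H1_bags :: "('a \<times> 'a) set \<Rightarrow> 'a \<Rightarrow> bool" where
  "H1_bags E b \<longleftrightarrow> (\<exists>A C D q i j p. b \<notin> A \<union> C \<union> D \<and> A \<inter> C = {} \<and> A \<inter> D = {} \<and> C \<inter> D = {} \<and>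
     out_bag E b C q \<and> (q, i) \<in> E \<and> reach E D i j \<and> (j, p) \<in> E \<and> in_bag E b A p)"

text \<open>Here both \<open>A\<close> and \<open>C\<close> are left, and \<open>d\<close> arises in
  \<open>D\<close> as the join of the two paths towards \<open>z\<close>.\<close>

definition H2_bags :: "('a \<times> 'a) set \<Rightarrow> 'a \<Rightarrow> bool" where
  "H2_bags E b \<longleftrightarrow> (\<exists>A C D q q' i i' z. b \<notin> A \<union> C \<union> D \<and> A \<inter> C = {} \<and> A \<inter> D = {} \<and> C \<inter> D = {} \<and>
     out_bag E b A q \<and> (q, i) \<in> E \<and> reach E D i z \<and> out_bag E b C q' \<and> (q', i') \<in> E \<and> reach E D i' z)"

lemma H1_bagsE:
  assumes "H1_bags E b"
  obtains A C D q i j p where "b \<notin> A \<union> C \<union> D" "A \<inter> C = {}" "A \<inter> D = {}" "C \<inter> D = {}"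
    "out_bag E b C q" "(q, i) \<in> E" "reach E D i j" "(j, p) \<in> E" "in_bag E b A p"
  using assms unfolding H1_bags_def
  apply -
  apply (erule exE)+
  apply (erule conjE)+
  apply (rule that)
          apply assumption+
  done

lemma H2_bagsE:
  assumes "H2_bags E b"
  obtains A C D q q' i i' z where "b \<notin> A \<union> C \<union> D" "A \<inter> C = {}" "A \<inter> D = {}" "C \<inter> D = {}"
    "out_bag E b A q" "(q, i) \<in> E" "reach E D i z" "out_bag E b C q'" "(q', i') \<in> E" "reach E D i' z"
  using assms unfolding H2_bags_def
  apply -
  apply (erule exE)+
  apply (erule conjE)+
  apply (rule that)
           apply assumption+
  done

lemma H1_bagsI:
  assumes "b \<notin> A \<union> C \<union> D" "A \<inter> C = {}" "A \<inter> D = {}" "C \<inter> D = {}"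
    "out_bag E b C q" "(q, i) \<in> E" "reach E D i j" "(j, p) \<in> E" "in_bag E b A p"
  shows "H1_bags E b"
  unfolding H1_bags_def by (intro exI conjI) (rule assms)+

lemma H2_bagsI:
  assumes "b \<notin> A \<union> C \<union> D" "A \<inter> C = {}" "A \<inter> D = {}" "C \<inter> D = {}"
    "out_bag E b A q" "(q, i) \<in> E" "reach E D i z" "out_bag E b C q'" "(q', i') \<in> E" "reach E D i' z"
  shows "H2_bags E b"
  unfolding H2_bags_def by (intro exI conjI) (rule assms)+

lemma out_bag_mono: "out_bag E b S q \<Longrightarrow> E \<subseteq> E' \<Longrightarrow> out_bag E' b S q"
  unfolding out_bag_def by (meson order_refl reach_mono subsetD)

lemma in_bag_mono: "in_bag E b S q \<Longrightarrow> E \<subseteq> E' \<Longrightarrow> in_bag E' b S q"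
  unfolding in_bag_def by (meson order_refl reach_mono subsetD)

lemma H1_bags_mono: "H1_bags E b \<Longrightarrow> E \<subseteq> E' \<Longrightarrow> H1_bags E' b"
  by (erule H1_bagsE, rule H1_bagsI) (assumption | erule (1) subsetD[rotated] out_bag_mono in_bag_mono
    | erule reach_mono, assumption, rule order_refl)+

lemma H2_bags_mono: "H2_bags E b \<Longrightarrow> E \<subseteq> E' \<Longrightarrow> H2_bags E' b"
  by (erule H2_bagsE, rule H2_bagsI) (assumption | erule (1) subsetD[rotated] out_bag_mono
    | erule reach_mono, assumption, rule order_refl)+

text \<open>An arc between \<open>R\<close> and the contracted vertex comes from an arc between
  \<open>R\<close> and some \<open>m\<close>. The conditions supply the missing path between
  \<open>m\<close> and \<open>v\<close> outside of \<open>R\<close>, in the direction of the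
  arc.\<close>

definition liftable :: "('a \<times> 'a) set \<Rightarrow> 'a set \<Rightarrow> 'a \<Rightarrow> bool" where
  "liftable E R v \<longleftrightarrow> v \<notin> R \<and>
     (\<forall>u\<in>R. \<forall>m. m \<notin> R \<longrightarrow> (u, m) \<in> E \<longrightarrow> reach E (- R) m v) \<and>
     (\<forall>u\<in>R. \<forall>m. m \<notin> R \<longrightarrow> (m, u) \<in> E \<longrightarrow> reach E (- R) v m)"

text \<open>Of several disjoint bags at most one contains \<open>v\<close>, so handing it the whole
  complement of \<open>R\<close> keeps the bags disjoint.\<close>

definition lift_bag :: "'a set \<Rightarrow> 'a \<Rightarrow> 'a set \<Rightarrow> 'a set" where
  "lift_bag R v S = (S \<inter> R) \<union> (if v \<in> S then - R else {})"

lemma contract_arc: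
  assumes "liftable E R v" "(x, y) \<in> contract E R v"
  obtains x' y' where "(x', y') \<in> E" "x' = x \<and> x \<in> R \<or> x = v \<and> reach E (- R) v x'"
     "y' = y \<and> y \<in> R \<or> y = v \<and> reach E (- R) y' v"
proof -
  have v: "v \<notin> R" "reach E (- R) v v" using assms(1) by (auto simp: liftable_def intro: reach_refl)
  from assms(2) consider "(x, y) \<in> E" "x \<in> insert v R" "y \<in> insert v R"
    | m where "x \<in> R" "y = v" "m \<notin> insert v R" "(x, m) \<in> E"
    | m where "y \<in> R" "x = v" "m \<notin> insert v R" "(m, y) \<in> E"
    unfolding contract_def by blast
  then show ?thesis
  proof cases
    case 1
    then show ?thesis using that[of x y] v by blast
  next
    case 2
    then show ?thesis using that[of x m] assms(1) by (auto simp: liftable_def)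
  next
    case 3
    then show ?thesis using that[of m y] assms(1) by (auto simp: liftable_def)
  qed
qed

lemma contract_arc_bags:
  assumes "liftable E R v" "(x, y) \<in> contract E R v" "x \<in> S" "y \<in> T"
  obtains x' y' where "(x', y') \<in> E" "reach E (lift_bag R v S) x x'" "reach E (lift_bag R v T) y' y"
proof -
  obtain x' y' where "(x', y') \<in> E" and x: "x' = x \<and> x \<in> R \<or> x = v \<and> reach E (- R) v x'"
    and y: "y' = y \<and> y \<in> R \<or> y = v \<and> reach E (- R) y' v"
    using contract_arc[OF assms(1,2)] .
  moreover have "reach E (lift_bag R v S) x x'"
    using x assms(3) by (auto simp: lift_bag_def intro: reach_refl reach_monoS)
  moreover have "reach E (lift_bag R v T) y' y"
    using y assms(4) by (auto simp: lift_bag_def intro: reach_refl reach_monoS)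
  ultimately show ?thesis using that by blast
qed

lemma lift_reach:
  assumes "liftable E R v" "reach (contract E R v) S x y" "x \<in> insert v R"
  shows "reach E (lift_bag R v S) x y"
  using assms(2)
proof (induction rule: reach_induct)
  case refl
  then show ?case using assms by (auto simp: lift_bag_def liftable_def intro!: reach_refl)
next
  case (step y z)
  obtain y' z' where "(y', z') \<in> E" "reach E (lift_bag R v S) y y'" "reach E (lift_bag R v S) z' z"
    using contract_arc_bags[OF assms(1) \<open>(y, z) \<in> contract E R v\<close> \<open>y \<in> S\<close> \<open>z \<in> S\<close>] .
  then show ?case using step.IH by (meson reach_cons reach_in(2) reach_trans)
qed

lemma contract_in: "(x, y) \<in> contract E R v \<Longrightarrow> x \<in> insert v R \<and> y \<in> insert v R"
  by (auto simp: contract_def)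

text \<open>As \<open>b\<close> is not \<open>v\<close>, the lift of the singleton bag of
  \<open>b\<close> adds nothing to it, so the lifted arc still starts at \<open>b\<close>
  itself.\<close>

lemma lift_from:
  assumes "liftable E R v" "(b, s) \<in> contract E R v" "b \<noteq> v" "s \<in> S"
  obtains s' where "(b, s') \<in> E" "reach E (lift_bag R v S) s' s"
proof -
  obtain b' s' where *: "(b', s') \<in> E" "reach E (lift_bag R v {b}) b b'" "reach E (lift_bag R v S) s' s"
    using contract_arc_bags[OF assms(1,2) singletonI assms(4)] .
  have "b' = b" using reach_in(2)[OF *(2)] assms(3) by (auto simp: lift_bag_def split: if_splits)
  then show ?thesis using that * by blast
qed

lemma lift_to:
  assumes "liftable E R v" "(t, b) \<in> contract E R v" "b \<noteq> v" "t \<in> S"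
  obtains t' where "(t', b) \<in> E" "reach E (lift_bag R v S) t t'"
proof -
  obtain t' b' where *: "(t', b') \<in> E" "reach E (lift_bag R v S) t t'" "reach E (lift_bag R v {b}) b' b"
    using contract_arc_bags[OF assms(1,2,4) singletonI] .
  have "b' = b" using reach_in(1)[OF *(3)] assms(3) by (auto simp: lift_bag_def split: if_splits)
  then show ?thesis using that * by blast
qed

lemma lift_out_bag:
  assumes "liftable E R v" "out_bag (contract E R v) b S q" "b \<noteq> v"
  shows "out_bag E b (lift_bag R v S) q"
proof -
  obtain s t where *: "(b, s) \<in> contract E R v" "reach (contract E R v) S s t" "(t, b) \<in> contract E R v"
    "reach (contract E R v) S s q" using assms(2) by (auto simp: out_bag_def)
  have s: "s \<in> insert v R" using contract_in[OF *(1)] by blast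
  obtain s' where s': "(b, s') \<in> E" "reach E (lift_bag R v S) s' s"
    using lift_from[OF assms(1) *(1) assms(3) reach_in(1)[OF *(2)]] .
  obtain t' where t': "(t', b) \<in> E" "reach E (lift_bag R v S) t t'"
    using lift_to[OF assms(1) *(3) assms(3) reach_in(2)[OF *(2)]] .
  show ?thesis unfolding out_bag_def
    using s' t' lift_reach[OF assms(1) *(2) s] lift_reach[OF assms(1) *(4) s] by (meson reach_trans)
qed

lemma lift_in_bag:
  assumes "liftable E R v" "in_bag (contract E R v) b S q" "b \<noteq> v" "q \<in> insert v R"
  shows "in_bag E b (lift_bag R v S) q"
proof -
  obtain s t where *: "(b, s) \<in> contract E R v" "reach (contract E R v) S s t" "(t, b) \<in> contract E R v"
    "reach (contract E R v) S q t" using assms(2) by (auto simp: in_bag_def)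
  have s: "s \<in> insert v R" using contract_in[OF *(1)] by blast
  obtain s' where s': "(b, s') \<in> E" "reach E (lift_bag R v S) s' s"
    using lift_from[OF assms(1) *(1) assms(3) reach_in(1)[OF *(2)]] .
  obtain t' where t': "(t', b) \<in> E" "reach E (lift_bag R v S) t t'"
    using lift_to[OF assms(1) *(3) assms(3) reach_in(2)[OF *(2)]] .
  show ?thesis unfolding in_bag_def
    using s' t' lift_reach[OF assms(1) *(2) s] lift_reach[OF assms(1) *(4) assms(4)] by (meson reach_trans)
qed

lemma out_bag_extend: "out_bag E b S q \<Longrightarrow> reach E S q q' \<Longrightarrow> out_bag E b S q'"
  unfolding out_bag_def by (meson reach_trans)

lemma in_bag_extend: "in_bag E b S q \<Longrightarrow> reach E S q' q \<Longrightarrow> in_bag E b S q'"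
  unfolding in_bag_def by (meson reach_trans)

lemma out_bag_in: "out_bag E b S q \<Longrightarrow> q \<in> S"
  unfolding out_bag_def by (meson reach_in)

lemma in_bag_in: "in_bag E b S q \<Longrightarrow> q \<in> S"
  unfolding in_bag_def by (meson reach_in)

lemma lift_bag_disjoint: "S \<inter> T = {} \<Longrightarrow> lift_bag R v S \<inter> lift_bag R v T = {}"
  by (auto simp: lift_bag_def)

lemma out_bag_base: "out_bag (contract E R v) b S q \<Longrightarrow> b \<noteq> v \<Longrightarrow> b \<in> R"
  unfolding out_bag_def using contract_in by fast

lemma lift_bag_base: "b \<notin> S \<Longrightarrow> b \<in> R \<Longrightarrow> b \<notin> lift_bag R v S"
  by (auto simp: lift_bag_def)

lemma H1_bags_lift:
  assumes "liftable E R v" "H1_bags (contract E R v) b" "b \<noteq> v"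
  shows "H1_bags E b"
proof -
  obtain A C D q i j p where *: "b \<notin> A \<union> C \<union> D" "A \<inter> C = {}" "A \<inter> D = {}" "C \<inter> D = {}"
     "out_bag (contract E R v) b C q" "(q, i) \<in> contract E R v" "reach (contract E R v) D i j"
     "(j, p) \<in> contract E R v" "in_bag (contract E R v) b A p"
    using assms(2) by (rule H1_bagsE)
  let ?l = "lift_bag R v"
  have inR: "i \<in> insert v R" "p \<in> insert v R" using contract_in[OF *(6)] contract_in[OF *(8)] by auto
  have b: "b \<in> R" using out_bag_base[OF *(5) assms(3)] .
  obtain q1 i1 where q: "(q1, i1) \<in> E" "reach E (?l C) q q1" "reach E (?l D) i1 i"
    using contract_arc_bags[OF assms(1) *(6) out_bag_in[OF *(5)] reach_in(1)[OF *(7)]] .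
  obtain j1 p1 where p: "(j1, p1) \<in> E" "reach E (?l D) j j1" "reach E (?l A) p1 p"
    using contract_arc_bags[OF assms(1) *(8) reach_in(2)[OF *(7)] in_bag_in[OF *(9)]] .
  show ?thesis
  proof (rule H1_bagsI)
    show "b \<notin> ?l A \<union> ?l C \<union> ?l D" using *(1) b lift_bag_base[of b _ R v] by blast
    show "?l A \<inter> ?l C = {}" "?l A \<inter> ?l D = {}" "?l C \<inter> ?l D = {}"
      using lift_bag_disjoint *(2-4) by metis+
    show "out_bag E b (?l C) q1"
      using out_bag_extend[OF lift_out_bag[OF assms(1) *(5) assms(3)] q(2)] .
    show "in_bag E b (?l A) p1"
      using in_bag_extend[OF lift_in_bag[OF assms(1) *(9) assms(3) inR(2)] p(3)] .
    show "reach E (?l D) i1 j1"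
      using reach_trans[OF q(3) reach_trans[OF lift_reach[OF assms(1) *(7) inR(1)] p(2)]] .
  qed (fact q(1) p(1))+
qed

lemma H2_bags_lift:
  assumes "liftable E R v" "H2_bags (contract E R v) b" "b \<noteq> v"
  shows "H2_bags E b"
proof -
  obtain A C D q q' i i' z where *: "b \<notin> A \<union> C \<union> D" "A \<inter> C = {}" "A \<inter> D = {}" "C \<inter> D = {}"
     "out_bag (contract E R v) b A q" "(q, i) \<in> contract E R v" "reach (contract E R v) D i z"
     "out_bag (contract E R v) b C q'" "(q', i') \<in> contract E R v" "reach (contract E R v) D i' z"
    using assms(2) by (rule H2_bagsE)
  let ?l = "lift_bag R v"
  have inR: "i \<in> insert v R" "i' \<in> insert v R" using contract_in[OF *(6)] contract_in[OF *(9)] by auto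
  have b: "b \<in> R" using out_bag_base[OF *(5) assms(3)] .
  obtain q1 i1 where q: "(q1, i1) \<in> E" "reach E (?l A) q q1" "reach E (?l D) i1 i"
    using contract_arc_bags[OF assms(1) *(6) out_bag_in[OF *(5)] reach_in(1)[OF *(7)]] .
  obtain q2 i2 where p: "(q2, i2) \<in> E" "reach E (?l C) q' q2" "reach E (?l D) i2 i'"
    using contract_arc_bags[OF assms(1) *(9) out_bag_in[OF *(8)] reach_in(1)[OF *(10)]] .
  show ?thesis
  proof (rule H2_bagsI)
    show "b \<notin> ?l A \<union> ?l C \<union> ?l D" using *(1) b lift_bag_base[of b _ R v] by blast
    show "?l A \<inter> ?l C = {}" "?l A \<inter> ?l D = {}" "?l C \<inter> ?l D = {}"
      using lift_bag_disjoint *(2-4) by metis+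
    show "out_bag E b (?l A) q1"
      using out_bag_extend[OF lift_out_bag[OF assms(1) *(5) assms(3)] q(2)] .
    show "out_bag E b (?l C) q2"
      using out_bag_extend[OF lift_out_bag[OF assms(1) *(8) assms(3)] p(2)] .
    show "reach E (?l D) i1 z" using reach_trans[OF q(3) lift_reach[OF assms(1) *(7) inR(1)]] .
    show "reach E (?l D) i2 z" using reach_trans[OF p(3) lift_reach[OF assms(1) *(10) inR(2)]] .
  qed (fact q(1) p(1))+
qed

subsection \<open>Minimal digraphs without a 3-colouring\<close>

text \<open>No directed cycle uses an arc of a one-way cut, so the two sides are coloured
  independently.\<close>

lemma colorable_cut:
  assumes E: "E \<subseteq> V \<times> V" and B: "B \<subseteq> V" "\<And>x y. x \<in> B \<Longrightarrow> (x, y) \<in> E \<Longrightarrow> y \<in> B"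
    and col: "colorable (Restr E B)" "colorable (Restr E (V - B))"
  shows "colorable E"
proof -
  obtain c1 :: "'a \<Rightarrow> nat" where c1: "range c1 \<subseteq> {..<3}" "acyclic (mono_arcs c1 (Restr E B))"
    using col(1) by (rule colorableE)
  obtain c2 :: "'a \<Rightarrow> nat" where c2: "range c2 \<subseteq> {..<3}" "acyclic (mono_arcs c2 (Restr E (V - B)))"
    using col(2) by (rule colorableE)
  define c where "c x = (if x \<in> B then c1 x else c2 x)" for x
  have "acyclic (mono_arcs c E)"
  proof (rule ccontr)
    assume "\<not> ?thesis"
    then obtain x y where xy: "(x, y) \<in> E" "c x = c y" "reach E {z. c z = c x} y x"
      by (rule not_acyclic_mono)
    define K where "K = {z. c z = c x}"
    have r: "reach E K y x" using xy(3) by (simp add: K_def)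
    show False
    proof (cases "x \<in> B")
      case True
      then have yB: "y \<in> B" using B(2) xy(1) by blast
      have "reach E (K \<inter> B) y z" if "reach E K y z" for z
        using that
      proof (induction rule: reach_induct)
        case refl
        then show ?case using yB by (simp add: reach_refl)
      next
        case (step z w)
        then have "w \<in> K \<inter> B" using B(2)[of z w] reach_in(2)[OF step.IH] by blast
        then show ?case by (rule reach_snoc[OF step.IH \<open>(z, w) \<in> E\<close>])
      qed
      then have r': "reach (Restr E B) (K \<inter> B) y x" using r by (intro reach_Restr) blast+
      have "c1 z = c x" if "z \<in> K \<inter> B" for z using that True by (simp add: K_def c_def split: if_splits)
      moreover have "(x, y) \<in> Restr E B" using True yB xy(1) by blast
      ultimately show False using acyclic_monoD[OF c1(2) _ r'] by blast
    next
      case False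
      have sub: "z \<in> V - B" if "reach E K z x" for z
        using that
      proof (induction rule: reach_converse_induct)
        case refl
        then show ?case using False xy(1) E by blast
      next
        case (step z w)
        then show ?case using B(2)[of z w] E by blast
      qed
      have yB: "y \<in> V - B" using sub[OF r] .
      have "reach E (K \<inter> (V - B)) z x" if "reach E K z x" for z
        using that
      proof (induction rule: reach_converse_induct)
        case refl
        then show ?case using False xy(1) E by (auto intro: reach_refl)
      next
        case (step z w)
        have "reach E K z x" using step reach_cons by metis
        then have "z \<in> K \<inter> (V - B)" using sub[of z] step by blast
        then show ?case by (rule reach_cons[OF \<open>(z, w) \<in> E\<close> step.IH])
      qed
      then have r': "reach (Restr E (V - B)) (K \<inter> (V - B)) y x" using r by (intro reach_Restr) blast+
      have "c2 z = c x" if "z \<in> K \<inter> (V - B)" for z using that False by (simp add: K_def c_def split: if_splits)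
      moreover have "(x, y) \<in> Restr E (V - B)" using False yB xy(1) E by blast
      ultimately show False using acyclic_monoD[OF c2(2) _ r'] by blast
    qed
  qed
  moreover have "range c \<subseteq> {..<3}" using c1(1) c2(1) by (simp add: c_def image_subset_iff)
  ultimately show ?thesis by (intro colorableI)
qed

text \<open>With arcs between \<open>R\<close> and \<open>M\<close> in one direction only, a cycle
  avoiding \<open>v\<close> cannot traverse both, so agreement at \<open>v\<close> suffices.\<close>

lemma colorable_combine:
  assumes E: "E \<subseteq> insert v (R \<union> M) \<times> insert v (R \<union> M)" and RM: "R \<inter> M = {}" "v \<notin> R" "v \<notin> M"
    and col: "colorable (contract E R v)" "colorable (Restr E (insert v M))"
    and one_way: "(\<forall>x\<in>R. \<forall>y\<in>M. (x, y) \<notin> E) \<or> (\<forall>x\<in>R. \<forall>y\<in>M. (y, x) \<notin> E)"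
  shows "colorable E"
proof -
  obtain c1 :: "'a \<Rightarrow> nat" where c1: "range c1 \<subseteq> {..<3}" "acyclic (mono_arcs c1 (contract E R v))" "c1 v = 0"
    using colorable_perm[OF col(1), of 0 v] by auto
  obtain c2 :: "'a \<Rightarrow> nat" where c2: "range c2 \<subseteq> {..<3}" "acyclic (mono_arcs c2 (Restr E (insert v M)))" "c2 v = 0"
    using colorable_perm[OF col(2), of 0 v] by auto
  have "acyclic (mono_arcs (\<lambda>x. if x \<in> insert v R then c1 x else c2 x) E)"
  proof (rule acyclic_mono_combine[OF E RM c1(2) c2(2)])
    fix i a e z b a' e' z' b'
    assume *: "a \<in> M" "(a, e) \<in> E" "reach E (R \<inter> {z. c1 z = i}) e z" "(z, b) \<in> E" "b \<in> M"
    have "e \<in> R" "z \<in> R" using reach_in[OF *(3)] by auto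
    then show False using * one_way by blast
  qed (simp add: c1 c2)
  moreover have "range (\<lambda>x. if x \<in> insert v R then c1 x else c2 x) \<subseteq> {..<3}"
    using c1(1) c2(1) by (auto simp: image_subset_iff)
  ultimately show ?thesis by (intro colorableI)
qed

lemma contract_subset: "contract E R v \<subseteq> insert v R \<times> insert v R"
  by (auto simp: contract_def)

lemma irrefl_contract: "irrefl E \<Longrightarrow> v \<notin> R \<Longrightarrow> irrefl (contract E R v)"
  by (auto simp: contract_def irrefl_def)

text \<open>Shared by \<open>H1\<close> and \<open>H2\<close>. In a smallest counterexample,
  \<open>mono\<close> makes proper induced subdigraphs colourable and \<open>lift\<close> does so
  for contractions whose part \<open>R\<close> avoids \<open>r\<close>. Gluing colourings then
  forces strong connectivity, also after the deletion of any \<open>v\<close> other than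
  \<open>r\<close>, which is the situation of \<open>core\<close>.\<close>

lemma rooted_induction:
  fixes HH :: "('a \<times> 'a) set \<Rightarrow> 'a \<Rightarrow> bool"
  assumes base: "\<And>E b. HH E b \<Longrightarrow> b \<in> Field E"
    and mono: "\<And>E E' b. HH E b \<Longrightarrow> E \<subseteq> E' \<Longrightarrow> HH E' b"
    and lift: "\<And>E R v b. liftable E R v \<Longrightarrow> HH (contract E R v) b \<Longrightarrow> b \<noteq> v \<Longrightarrow> HH E b"
    and core: "\<And>V E v r. finite V \<Longrightarrow> E \<subseteq> V \<times> V \<Longrightarrow> irrefl E \<Longrightarrow> v \<in> V \<Longrightarrow> v \<noteq> r \<Longrightarrow>
      strong E (V - {v}) \<Longrightarrow> \<not> colorable E \<Longrightarrow> (\<And>W. W \<subset> V \<Longrightarrow> colorable (Restr E W)) \<Longrightarrow>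
      (\<And>R. R \<subset> V - {v} \<Longrightarrow> r \<notin> R \<Longrightarrow> liftable E R v \<Longrightarrow> colorable (contract E R v)) \<Longrightarrow> HH E v"
  assumes "finite V" "E \<subseteq> V \<times> V" "irrefl E" "\<not> colorable E"
  shows "\<exists>b. b \<noteq> r \<and> HH E b"
  using assms(5-)
proof (induction "card V" arbitrary: V E r rule: less_induct)
  case less
  note fin = \<open>finite V\<close> and E = \<open>E \<subseteq> V \<times> V\<close> and irr = \<open>irrefl E\<close> and ncol = \<open>\<not> colorable E\<close>
  show ?case
  proof (rule ccontr)
    assume noH: "\<nexists>b. b \<noteq> r \<and> HH E b"
    have sub: "colorable (Restr E W)" if "W \<subset> V" for W
    proof (rule ccontr)
      assume nc: "\<not> colorable (Restr E W)"
      have f: "finite W" using that fin by (meson finite_subset psubset_imp_subset)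
      have i: "irrefl (Restr E W)" using irr by (auto simp: irrefl_def)
      have "\<exists>b. b \<noteq> r \<and> HH (Restr E W) b"
        using less(1)[OF psubset_card_mono[OF fin that] f _ i nc] by blast
      then show False using noH mono[of "Restr E W" _ E] by blast
    qed
    have ctr: "colorable (contract E R v)" if "v \<in> V" "R \<subset> V - {v}" "r \<notin> R" "liftable E R v" for R v
    proof (rule ccontr)
      have ps: "insert v R \<subset> V" using that by blast
      have "v \<notin> R" using that(2) by blast
      then have irr': "irrefl (contract E R v)" by (rule irrefl_contract[OF irr])
      have fin': "finite (insert v R)" using ps fin by (meson finite_subset psubset_imp_subset)
      \<comment> \<open>The induction hypothesis is used with root \<open>v\<close>, not
        \<open>r\<close>. The \<open>b\<close> that it yields lies in \<open>R\<close> by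
        \<open>base\<close>, and \<open>r\<close> does not.\<close>
      assume "\<not> colorable (contract E R v)"
      then obtain b where b: "b \<noteq> v" "HH (contract E R v) b"
        using less(1)[OF psubset_card_mono[OF fin ps] fin' contract_subset irr'] by blast
      then have "b \<in> R" using base[OF b(2)] contract_subset[of E R v] by (auto simp: Field_def)
      then have "b \<noteq> r" using that(3) by metis
      then show False using lift[OF that(4) b(2,1)] noH by metis
    qed
    have strV: "strong E V"
    proof (rule ccontr)
      assume "\<not> ?thesis"
      then obtain x y where xy: "x \<in> V" "y \<in> V" "\<not> reach E V x y" by (auto simp: strong_def)
      define B where "B = {z. reach E V x z}"
      have B: "B \<subseteq> V" "x \<in> B" "y \<notin> B"
        using xy reach_in(2)[of E V x] by (auto simp: B_def reach_refl)
      have cl: "b \<in> B" if "a \<in> B" "(a, b) \<in> E" for a b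
        using that E reach_snoc[of E V x a b] by (auto simp: B_def)
      have ps: "B \<subset> V" "V - B \<subset> V" using B xy by auto
      have "colorable E" by (rule colorable_cut[OF E B(1) cl sub[OF ps(1)] sub[OF ps(2)]])
      then show False using ncol by simp
    qed
    have str: "strong E (V - {v})" if v: "v \<in> V" "v \<noteq> r" for v
    proof (rule ccontr)
      assume "\<not> ?thesis"
      then obtain x y where xy: "x \<in> V - {v}" "y \<in> V - {v}" "\<not> reach E (V - {v}) x y"
        unfolding strong_def by blast
      define B where "B = {z. reach E (V - {v}) x z}"
      define A where "A = V - {v} - B"
      have B: "B \<subseteq> V - {v}" "x \<in> B" "y \<in> A"
        using xy by (auto simp: B_def A_def reach_refl dest: reach_in)
      have noarc: "(p, q) \<notin> E" if "p \<in> B" "q \<in> A" for p q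
      proof
        assume "(p, q) \<in> E"
        then have "reach E (V - {v}) x q" using that by (auto simp: B_def A_def intro: reach_snoc)
        then show False using that by (simp add: A_def B_def)
      qed
      have V: "V = insert v (A \<union> B)" "A \<inter> B = {}" "v \<notin> A" "v \<notin> B" using B v by (auto simp: A_def)
      \<comment> \<open>Since \<open>V\<close> is strong and no arc leads from \<open>B\<close> to
        \<open>A\<close>, every vertex of \<open>B\<close> reaches \<open>v\<close> inside
        \<open>insert v B\<close>. Dually, \<open>v\<close> reaches every vertex of \<open>A\<close>
        inside \<open>insert v A\<close>.\<close>
      have liftA: "liftable E A v"
        unfolding liftable_def
      proof (intro conjI ballI allI impI)
        fix u m assume u: "u \<in> A" "m \<notin> A" "(u, m) \<in> E"
        show "reach E (- A) m v"
        proof (cases "m = v")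
          case True
          then show ?thesis using V by (auto intro: reach_refl)
        next
          case False
          then have m: "m \<in> B" using u E V by auto
          then have "reach E V m v" using strV V v by (auto simp: strong_def)
          then obtain p q where "reach E (V \<inter> B) m p" "(p, q) \<in> E" "q \<in> V - B"
            using reach_exit[OF _ m V(4)] by metis
          moreover from this have "q = v" using noarc V reach_in(2)[of E "V \<inter> B" m p] by blast
          ultimately show ?thesis
            using V by (intro reach_snoc[of E "- A" m p v]) (auto elim: reach_monoS)
        qed
      next
        fix u m assume "u \<in> A" "m \<notin> A" "(m, u) \<in> E"
        then have "m = v" using noarc E V by blast
        then show "reach E (- A) v m" using V by (auto intro: reach_refl)
      qed (fact V)
      have liftB: "liftable E B v"
        unfolding liftable_def
      proof (intro conjI ballI allI impI)
        fix u m assume u: "u \<in> B" "m \<notin> B" "(m, u) \<in> E"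
        show "reach E (- B) v m"
        proof (cases "m = v")
          case True
          then show ?thesis using V by (auto intro: reach_refl)
        next
          case False
          then have m: "m \<in> A" using u E V by auto
          then have "reach E V v m" using strV V v by (auto simp: strong_def)
          then obtain p q where "p \<in> V - A" "(p, q) \<in> E" "reach E (V \<inter> A) q m"
            using reach_entry[OF _ V(3) m] by metis
          moreover from this have "p = v" using noarc V reach_in(1)[of E "V \<inter> A" q m] by blast
          ultimately show ?thesis
            using V by (intro reach_cons[of v q E "- B" m]) (auto elim: reach_monoS)
        qed
      next
        fix u m assume "u \<in> B" "m \<notin> B" "(u, m) \<in> E"
        then have "m = v" using noarc E V by blast
        then show "reach E (- B) m v" using V by (auto intro: reach_refl)
      qed (fact V)
      have pA: "A \<subset> V - {v}" "insert v A \<subset> V" and pB: "B \<subset> V - {v}" "insert v B \<subset> V"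
        using V B by auto
      show False
      \<comment> \<open>The side that contains \<open>r\<close> is the one to be merged into
        \<open>v\<close>.\<close>
      proof (cases "r \<in> B")
        case True
        then have "r \<notin> A" using V by blast
        have "colorable E"
        proof (rule colorable_combine[of E v A B])
          show "colorable (contract E A v)" by (rule ctr) fact+
          show "colorable (Restr E (insert v B))" by (rule sub) fact
          show "E \<subseteq> insert v (A \<union> B) \<times> insert v (A \<union> B)" using E V(1) by metis
        qed (use V noarc in auto)
        then show False using ncol by blast
      next
        case False
        have "colorable E"
        proof (rule colorable_combine[of E v B A])
          show "colorable (contract E B v)" by (rule ctr) fact+
          show "colorable (Restr E (insert v A))" by (rule sub) fact
          show "E \<subseteq> insert v (B \<union> A) \<times> insert v (B \<union> A)" using E V(1) by (metis Un_commute)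
        qed (use V noarc in auto)
        then show False using ncol by blast
      qed
    qed
    \<comment> \<open>If \<open>r\<close> were the only possible vertex, irreflexivity would leave
      no arcs, and any constant colouring would do.\<close>
    obtain v where v: "v \<in> V" "v \<noteq> r"
    proof (rule ccontr)
      assume "\<not> thesis"
      then have "V \<subseteq> {r}" using that by blast
      then have "E = {}" using E irr by (auto simp: irrefl_def)
      then have "mono_arcs (\<lambda>_. 0) E = {}" by (simp add: mono_arcs_def)
      then have "acyclic (mono_arcs (\<lambda>_. 0) E)" by (simp add: acyclic_def)
      then have "colorable E" by (intro colorableI[of "\<lambda>_. 0"]) auto
      then show False using ncol by simp
    qed
    have "HH E v"
      by (rule core[OF fin E irr v str[OF v] ncol sub ctr[OF v(1)]])
    then show False using noH v by blast
  qed
qed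

subsection \<open>Cycles through a vertex\<close>

text \<open>The vertices of a directed cycle through \<open>v\<close>, in order and without
  \<open>v\<close>.\<close>

definition vpath :: "('a \<times> 'a) set \<Rightarrow> 'a \<Rightarrow> 'a list \<Rightarrow> bool" where
  "vpath E v xs \<longleftrightarrow> xs \<noteq> [] \<and> walk E xs \<and> distinct xs \<and> v \<notin> set xs \<and> (v, hd xs) \<in> E \<and> (last xs, v) \<in> E"

text \<open>A generalised cycle through \<open>v\<close>: every vertex of \<open>F\<close> can be
  both the exit of an \<open>out_bag\<close> and the entry of an \<open>in_bag\<close>.\<close>

definition vbag :: "('a \<times> 'a) set \<Rightarrow> 'a \<Rightarrow> 'a set \<Rightarrow> bool" where
  "vbag E v F \<longleftrightarrow> v \<notin> F \<and> (\<exists>s\<in>F. \<exists>t\<in>F. (v, s) \<in> E \<and> (t, v) \<in> E \<and> (\<forall>x\<in>F. reach E F s x \<and> reach E F x t))"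

lemma vbag_notin: "vbag E v F \<Longrightarrow> v \<notin> F"
  unfolding vbag_def by (rule conjunct1)

lemma vbag_nonempty: "vbag E v F \<Longrightarrow> F \<noteq> {}"
  unfolding vbag_def by (elim conjE bexE) blast

lemma vbag_out: "vbag E v F \<Longrightarrow> x \<in> F \<Longrightarrow> out_bag E v F x"
  unfolding vbag_def out_bag_def by blast

lemma vbag_in: "vbag E v F \<Longrightarrow> x \<in> F \<Longrightarrow> in_bag E v F x"
  unfolding vbag_def in_bag_def by blast

lemma vpath_vbag:
  assumes "vpath E v xs"
  shows "vbag E v (set xs)"
proof -
  obtain s ys where xs: "xs = s # ys" using assms by (cases xs) (auto simp: vpath_def)
  have w: "walk E xs" using assms by (simp add: vpath_def)
  have "reach E (set xs) s x" if "x \<in> set xs" for x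
    using walk_reach[of E "[]" s ys x] w xs that by auto
  moreover have "reach E (set xs) x (last xs)" if "x \<in> set xs" for x
    using walk_reach_last[of E xs "[]" x] w that by auto
  ultimately show ?thesis
    using assms xs unfolding vbag_def vpath_def
    by (intro conjI bexI[of _ s] bexI[of _ "last xs"]) auto
qed

text \<open>\<open>c\<close> is a good colouring away from \<open>v\<close>, so a cycle that appears
  when \<open>v\<close> gets colour \<open>i\<close> passes through \<open>v\<close>, and its other
  vertices have colour \<open>i\<close>.\<close>

lemma color_vpath:
  fixes c :: "'a \<Rightarrow> nat"
  assumes E: "E \<subseteq> V \<times> V" "irrefl E"
    and c: "acyclic (mono_arcs c (Restr E (V - {v})))" and n: "\<not> acyclic (mono_arcs (c(v := i)) E)"
  obtains xs where "vpath E v xs" "\<And>x. x \<in> set xs \<Longrightarrow> c x = i"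
proof -
  define K where "K = {z. (c(v := i)) z = i}"
  obtain x y where xy: "(x, y) \<in> E" "(c(v := i)) x = (c(v := i)) y"
    "reach E {z. (c(v := i)) z = (c(v := i)) x} y x"
    using n by (rule not_acyclic_mono)
  define K' where "K' = {z. (c(v := i)) z = (c(v := i)) x}"
  have r: "reach E K' y x" using xy(3) by (simp add: K'_def)
  have xK: "x \<in> K'" by (simp add: K'_def)
  have "\<exists>s. (v, s) \<in> E \<and> reach E K' s v"
  proof (cases "x = v")
    case True
    then show ?thesis using xy(1) r by blast
  next
    case False
    have "\<not> reach E (K' \<inter> - {v}) y x"
    proof
      assume r': "reach E (K' \<inter> - {v}) y x"
      have yV: "y \<in> V - {v}" "x \<in> V - {v}" using reach_in[OF r'] xy(1) E by auto
      have "reach E (K' \<inter> (V - {v})) y x"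
        using r'
      proof (induction rule: reach_induct)
        case refl
        then show ?case using yV by (intro reach_refl) auto
      next
        case (step a b)
        then show ?case using E by (intro reach_snoc[OF step.IH]) auto
      qed
      then have r'': "reach (Restr E (V - {v})) (K' \<inter> (V - {v})) y x" by (rule reach_Restr) auto
      show False
        by (rule acyclic_monoD[OF c _ r'', of "c x"]) (use yV xy(1) in \<open>auto simp: K'_def\<close>)
    qed
    then obtain z where "z \<in> K' - (- {v})" "reach E K' y z" "reach E K' z x"
      using reach_split[OF r, of "- {v}"] by blast
    then have z: "reach E K' y v" "reach E K' v x" by auto
    have "x \<notin> {v}" using False by simp
    then obtain u w where u: "reach E (K' \<inter> {v}) v u" "(u, w) \<in> E" "reach E K' w x"
      by (rule reach_exit[OF z(2) singletonI])
    moreover have "u = v" using reach_in(2)[OF u(1)] by blast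
    moreover have "reach E K' x v" using reach_cons[OF xy(1) z(1) xK] .
    ultimately show ?thesis by (meson reach_trans)
  qed
  then obtain s where s: "(v, s) \<in> E" "reach E K' s v" by blast
  have "s \<notin> {v}" using s E by (auto simp: irrefl_def)
  then obtain t w where t: "reach E (K' \<inter> - {v}) s t" "(t, w) \<in> E" "w \<in> K' - (- {v})"
    using reach_exit[OF s(2), of "- {v}"] by blast
  then have w: "w = v" by blast
  obtain xs where xs: "walk E (s # xs)" "distinct (s # xs)" "set (s # xs) \<subseteq> K' \<inter> - {v}" "last (s # xs) = t"
    using reach_walk[OF t(1)] .
  have vK: "v \<in> K'" using reach_in[OF s(2)] by blast
  have "c z = i" if "z \<in> set (s # xs)" for z
    using subsetD[OF xs(3) that] vK by (auto simp: K'_def)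
  moreover have "vpath E v (s # xs)" using xs t s w unfolding vpath_def by auto
  ultimately show ?thesis using that by blast
qed

text \<open>Each of the three colours fails at \<open>v\<close> and contributes a cycle; cycles of
  different colours share only \<open>v\<close>. The number of colours enters the existence of
  subdivisions here.\<close>

lemma three_vpaths:
  assumes E: "E \<subseteq> V \<times> V" "irrefl E" and col: "colorable (Restr E (V - {v}))" and n: "\<not> colorable E"
  obtains p1 p2 p3 where "vpath E v p1" "vpath E v p2" "vpath E v p3"
    "set p1 \<inter> set p2 = {}" "set p1 \<inter> set p3 = {}" "set p2 \<inter> set p3 = {}"
proof -
  obtain c :: "'a \<Rightarrow> nat" where c: "range c \<subseteq> {..<3}" "acyclic (mono_arcs c (Restr E (V - {v})))"
    using col by (rule colorableE)
  have "\<exists>xs. vpath E v xs \<and> (\<forall>x\<in>set xs. c x = i)" if "i < 3" for i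
  proof -
    have "range (c(v := i)) \<subseteq> {..<3}" using c(1) that by (auto simp: image_subset_iff)
    then have "\<not> acyclic (mono_arcs (c(v := i)) E)" using n colorableI by metis
    from color_vpath[OF E c(2) this] show ?thesis by metis
  qed
  from this[of 0] this[of 1] this[of 2] obtain p1 p2 p3 where
    p: "vpath E v p1" "\<forall>x\<in>set p1. c x = 0" "vpath E v p2" "\<forall>x\<in>set p2. c x = 1"
       "vpath E v p3" "\<forall>x\<in>set p3. c x = 2" by auto
  then show ?thesis using that[of p1 p2 p3] by (metis disjoint_iff n_not_Suc_n numeral_2_eq_2 One_nat_def zero_neq_numeral zero_neq_one)
qed

lemma vpath_in: "vpath E v xs \<Longrightarrow> E \<subseteq> V \<times> V \<Longrightarrow> set xs \<subseteq> V - {v}"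
proof
  fix x assume *: "vpath E v xs" "E \<subseteq> V \<times> V" "x \<in> set xs"
  then obtain us vs where xs: "xs = us @ x # vs" by (meson split_list)
  have "x \<in> V"
  proof (cases vs)
    case Nil
    then show ?thesis using * xs by (auto simp: vpath_def)
  next
    case (Cons y ys)
    then have "(x, y) \<in> E" using * xs by (auto simp: vpath_def successively_append_iff)
    then show ?thesis using * by blast
  qed
  then show "x \<in> V - {v}" using * by (auto simp: vpath_def)
qed

subsection \<open>The digraph \<open>H1\<close>\<close>

text \<open>\<open>C\<close> and \<open>A\<close> provide the two digons at \<open>v\<close>. The
  condition that \<open>w\<close> is outside of \<open>A\<close> leaves at least one vertex between
  the bags to serve as \<open>d\<close>; a bare arc from \<open>C\<close> to \<open>A\<close> would
  not do.\<close>

lemma H1_ear: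
  assumes C: "vbag E v C" and A: "vbag E v A" and CA: "C \<inter> A = {}"
    and x: "x \<in> C" "(x, w) \<in> E" and w: "w \<notin> A" and r: "reach E (- {v} - C) w a" and a: "a \<in> A"
  shows "H1_bags E v"
proof -
  have "w \<in> - A" "a \<notin> - A" using w a by auto
  then obtain u b where u: "reach E ((- {v} - C) \<inter> - A) w u" "(u, b) \<in> E" "b \<in> (- {v} - C) - - A"
    by (rule reach_exit[OF r])
  show ?thesis
  proof (rule H1_bagsI)
    have "v \<notin> A" "v \<notin> C" using vbag_notin C A by metis+
    then show "v \<notin> A \<union> C \<union> ((- {v} - C) \<inter> - A)" by blast
    show "out_bag E v C x" using vbag_out[OF C x(1)] .
    show "in_bag E v A b" using vbag_in[OF A] u(3) by blast
    show "reach E ((- {v} - C) \<inter> - A) w u" by (fact u(1))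
    show "A \<inter> C = {}" using CA by blast
    show "(x, w) \<in> E" by fact
    show "(u, b) \<in> E" by fact
    show "A \<inter> ((- {v} - C) \<inter> - A) = {}" by blast
    show "C \<inter> ((- {v} - C) \<inter> - A) = {}" by blast
  qed
qed

lemma vpath_switch:
  assumes "vpath E v (us @ s # vs)" "vpath E v (ms @ y # zs)" "(s, y) \<in> E"
    "set (us @ s # vs) \<inter> set (ms @ y # zs) = {}"
  shows "vpath E v (us @ s # y # zs)"
proof -
  have w: "walk E ((us @ [s]) @ vs)" "walk E (ms @ y # zs)" using assms(1,2) by (simp_all add: vpath_def)
  have "walk E (us @ [s])" "walk E (y # zs)"
    using w(1) w(2) successively_append_iff[of _ "us @ [s]" vs] successively_append_iff[of _ ms "y # zs"]
    by blast+
  then have "walk E ((us @ [s]) @ y # zs)"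
    using assms(3) successively_append_iff[of _ "us @ [s]" "y # zs"] by simp
  moreover have "distinct (us @ s # y # zs)" using assms(1,2,4) unfolding vpath_def by auto
  moreover have "hd (us @ s # y # zs) = hd (us @ s # vs)" by (cases us) auto
  ultimately show ?thesis using assms(1,2) unfolding vpath_def by simp
qed

text \<open>
  The paths \<open>p1\<close> and \<open>us @ s # vs\<close> exchange their tails along \<open>(s, y)\<close>, and so do \<open>p1\<close> and
  \<open>p3\<close> along \<open>(p, q)\<close>. The abandoned segment \<open>vs\<close> leads from the first new path to the second.
\<close>

lemma H1_order:
  assumes p1: "vpath E v p1" and p2: "vpath E v (us @ s # vs)" and p3: "vpath E v p3"
    and disj: "set p1 \<inter> set (us @ s # vs) = {}" "set p1 \<inter> set p3 = {}" "set (us @ s # vs) \<inter> set p3 = {}"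
    and y: "(s, y) \<in> E" "y \<in> set p1" and z: "s' \<in> set vs" "(s', z) \<in> E" "z \<in> set p3"
    and q: "(p, q) \<in> E" "p \<in> set p1" "q \<in> set p3"
  shows "H1_bags E v"
proof -
  have v: "v \<notin> set p1" "v \<notin> set (us @ s # vs)" "v \<notin> set p3"
    using p1 p2 p3 by (auto simp: vpath_def)
  obtain l1 l2 where l: "p1 = l1 @ p # l2" using q(2) by (meson split_list)
  show ?thesis
  \<comment> \<open>If \<open>y\<close> does not come after \<open>p\<close> on \<open>p1\<close>,
    the exchanged paths would overlap, but then the segment from \<open>y\<close> to
    \<open>p\<close> followed by \<open>q\<close> is itself an ear from the second path to
    \<open>p3\<close>.\<close>
  proof (cases "y \<in> set (l1 @ [p])")
    case True
    have "walk E ((l1 @ [p]) @ l2)" using p1 l by (simp add: vpath_def)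
    from walk_reach_last[OF this True order_refl] have "reach E (set (l1 @ [p])) y p" by simp
    then have yp: "reach E (- {v} - set (us @ s # vs)) y p"
      by (rule reach_monoS) (use v l disj in auto)
    have "reach E (- {v} - set (us @ s # vs)) y q"
      by (rule reach_snoc[OF yp q(1)]) (use v q disj in auto)
    then show ?thesis
      using H1_ear[OF vpath_vbag[OF p2] vpath_vbag[OF p3] disj(3) _ y(1) _ _ q(3)] y(2) disj by auto
  next
    case False
    then obtain m1 m2 where m: "l2 = m1 @ y # m2" using y(2) l by (auto dest: split_list)
    obtain n1 n2 where n: "p3 = n1 @ q # n2" using q(3) by (meson split_list)
    define C where "C = us @ s # y # m2"
    define A where "A = l1 @ p # q # n2"
    have C: "vpath E v C" unfolding C_def
      by (rule vpath_switch[OF p2, of "l1 @ p # m1"]) (use p1 l m y disj in auto)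
    have A: "vpath E v A" unfolding A_def
      by (rule vpath_switch[of E v l1 p l2 n1]) (use p1 p3 l n q disj in auto)
    have d1: "distinct p1" "distinct (us @ s # vs)" "distinct p3" using p1 p2 p3 by (auto simp: vpath_def)
    have CA: "set C \<inter> set A = {}"
    proof -
      have "set C = set (us @ [s]) \<union> set (y # m2)" "set A = set (l1 @ [p]) \<union> set (q # n2)"
        by (auto simp: C_def A_def)
      moreover have "set (y # m2) \<inter> set (l1 @ [p]) = {}" using d1(1) unfolding l m by auto
      moreover have "set (y # m2) \<subseteq> set p1" "set (l1 @ [p]) \<subseteq> set p1" unfolding l m by auto
      moreover have "set (q # n2) \<subseteq> set p3" unfolding n by auto
      moreover have "set (us @ [s]) \<subseteq> set (us @ s # vs)" by auto
      ultimately show ?thesis using disj by blast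
    qed
    obtain w ws where w: "vs = w # ws" using z(1) by (cases vs) auto
    have walk2: "walk E (us @ s # w # ws)" using p2 w by (simp add: vpath_def)
    have sw: "(s, w) \<in> E" using walk2 by (simp add: successively_append_iff)
    have "walk E ((us @ [s]) @ w # ws)" using walk2 by simp
    from walk_reach[OF this, of s' "set vs"] have "reach E (set vs) w s'" using z(1) w by auto
    then have "reach E (- {v} - set C) w s'"
      by (rule reach_monoS) (use v d1 disj l m in \<open>auto simp: C_def\<close>)
    then have wz: "reach E (- {v} - set C) w z"
      by (rule reach_snoc) (use z v disj l m in \<open>auto simp: C_def\<close>)
    \<comment> \<open>\<open>z\<close> may lie on the part of \<open>p3\<close> that was cut off.
      Following \<open>p3\<close> to its end reaches \<open>A\<close> in any case.\<close>
    have "reach E (set p3) z (last p3)"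
      using walk_reach_last[of E p3 "[]" z "set p3"] p3 z(3) by (simp add: vpath_def)
    then have "reach E (- {v} - set C) z (last p3)"
      by (rule reach_monoS) (use v disj l m in \<open>auto simp: C_def\<close>)
    with wz have wl: "reach E (- {v} - set C) w (last p3)" by (rule reach_trans)
    have "last p3 \<in> set A" using n by (auto simp: A_def)
    moreover have "w \<notin> set A" using w disj l n by (auto simp: A_def)
    moreover have "s \<in> set C" by (simp add: C_def)
    ultimately show ?thesis
      using H1_ear[OF vpath_vbag[OF C] vpath_vbag[OF A] CA _ sw _ wl] by blast
  qed
qed

text \<open>After the last departure from \<open>C\<close>, a path to \<open>A\<close> would be an
  ear unless its first step lands in \<open>A\<close>.\<close>

lemma H1_or_arc:
  assumes str: "strong E (V - {v})" and C: "vbag E v C" "C \<subseteq> V - {v}" and A: "vbag E v A" "A \<subseteq> V - {v}"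
    and CA: "C \<inter> A = {}" and nH: "\<not> H1_bags E v"
  obtains x y where "x \<in> C" "y \<in> A" "(x, y) \<in> E"
proof -
  obtain c a where ca: "c \<in> C" "a \<in> A" using vbag_nonempty[OF C(1)] vbag_nonempty[OF A(1)] by blast
  then have r: "reach E (V - {v}) c a" using str C A unfolding strong_def by blast
  have "c \<notin> - C" "a \<in> - C" using ca CA by auto
  then obtain u w where u: "u \<in> (V - {v}) - - C" "(u, w) \<in> E" "reach E ((V - {v}) \<inter> - C) w a"
    by (rule reach_entry[OF r])
  have "w \<in> A"
  proof (rule ccontr)
    assume w: "w \<notin> A"
    have "reach E (- {v} - C) w a" by (rule reach_monoS[OF u(3)]) auto
    then show False using H1_ear[OF C(1) A(1) CA _ u(2) w _ ca(2)] u(1) nH by blast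
  qed
  then show ?thesis using that u by blast
qed

lemma H1_core:
  assumes E: "E \<subseteq> V \<times> V" and str: "strong E (V - {v})"
    and p: "vpath E v p1" "vpath E v p2" "vpath E v p3"
    and disj: "set p1 \<inter> set p2 = {}" "set p1 \<inter> set p3 = {}" "set p2 \<inter> set p3 = {}"
  shows "H1_bags E v"
proof (rule ccontr)
  assume nH: "\<not> ?thesis"
  define S1 S2 S3 where S: "S1 = set p1" "S2 = set p2" "S3 = set p3"
  have b: "vbag E v S1" "vbag E v S2" "vbag E v S3" using p vpath_vbag by (auto simp: S)
  have sub: "S1 \<subseteq> V - {v}" "S2 \<subseteq> V - {v}" "S3 \<subseteq> V - {v}"
    using vpath_in[OF _ E] p by (auto simp: S)
  have d: "S1 \<inter> S2 = {}" "S1 \<inter> S3 = {}" "S2 \<inter> S3 = {}" "S2 \<inter> S1 = {}" "S3 \<inter> S1 = {}" "S3 \<inter> S2 = {}"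
    using disj by (auto simp: S)
  obtain x13 y13 where a13: "x13 \<in> S1" "y13 \<in> S3" "(x13, y13) \<in> E"
    using H1_or_arc[OF str b(1) sub(1) b(3) sub(3) d(2) nH] .
  obtain x31 y31 where a31: "x31 \<in> S3" "y31 \<in> S1" "(x31, y31) \<in> E"
    using H1_or_arc[OF str b(3) sub(3) b(1) sub(1) d(5) nH] .
  obtain x y where a12: "x \<in> S1" "y \<in> S2" "(x, y) \<in> E"
    using H1_or_arc[OF str b(1) sub(1) b(2) sub(2) d(1) nH] .
  obtain s' z where a23: "s' \<in> S2" "z \<in> S3" "(s', z) \<in> E"
    using H1_or_arc[OF str b(2) sub(2) b(3) sub(3) d(3) nH] .
  \<comment> \<open>Whichever of \<open>s\<close> and \<open>s'\<close> comes first on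
    \<open>p2\<close>, \<open>H1_order\<close> applies, with \<open>p1\<close> and \<open>p3\<close>
    swapped in the second case. So all arcs from \<open>S2\<close> to \<open>S1\<close> leave from
    the vertex \<open>s'\<close>, which also has an arc to \<open>S3\<close>.\<close>
  have tail: "s = s'" if s: "s \<in> S2" "h \<in> S1" "(s, h) \<in> E" for s h
  proof (rule ccontr)
    assume ne: "s \<noteq> s'"
    obtain us vs where us: "p2 = us @ s # vs" using s(1) by (auto simp: S dest: split_list)
    consider "s' \<in> set vs" | "s' \<in> set us" using a23(1) ne us by (auto simp: S)
    then show False
    proof cases
      case 1
      have "H1_bags E v"
        by (rule H1_order[OF p(1) p(2)[unfolded us] p(3) _ _ _ s(3) _ 1 a23(3) _ a13(3)])
           (use a13 a23 s disj us in \<open>auto simp: S\<close>)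
      then show False using nH by simp
    next
      case 2
      then obtain as bs where as: "us = as @ s' # bs" by (meson split_list)
      have us': "p2 = as @ s' # (bs @ s # vs)" using us as by simp
      have sv: "s \<in> set (bs @ s # vs)" by simp
      have "H1_bags E v"
        by (rule H1_order[OF p(3) p(2)[unfolded us'] p(1) _ _ _ a23(3) _ sv s(3) _ a31(3)])
           (use a31 a23 s d us' in \<open>auto simp: S\<close>)
      then show False using nH by simp
    qed
  qed
  \<comment> \<open>The goal is an ear from \<open>S1\<close> to \<open>S3\<close> through
    \<open>y\<close>. Leave from \<open>y\<close> until the first arrival in \<open>S1\<close> or
    \<open>S3\<close>; the vertex \<open>u\<close> before it has an arc to \<open>S3\<close> even if
    the arrival is in \<open>S1\<close>, by \<open>tail\<close>.\<close>
  have "reach E (V - {v}) y x" using str a12 sub unfolding strong_def by blast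
  moreover have "y \<in> - (S1 \<union> S3)" "x \<notin> - (S1 \<union> S3)" using a12 d by auto
  ultimately obtain u h where u: "reach E ((V - {v}) \<inter> - (S1 \<union> S3)) y u" "(u, h) \<in> E"
    "h \<in> (V - {v}) - - (S1 \<union> S3)" by (rule reach_exit)
  \<comment> \<open>Otherwise the path has left \<open>S2\<close> into vertices outside of all three
    cycles before the arrival, which is an ear from \<open>S2\<close>.\<close>
  have uS: "u \<in> S2"
  proof (rule ccontr)
    assume "u \<notin> S2"
    then have "y \<notin> - S2" "u \<in> - S2" using a12 by auto
    then obtain s w where w: "s \<in> ((V - {v}) \<inter> - (S1 \<union> S3)) - - S2" "(s, w) \<in> E"
      "reach E (((V - {v}) \<inter> - (S1 \<union> S3)) \<inter> - S2) w u" by (rule reach_entry[OF u(1)])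
    have "reach E (- {v} - S2) w u" by (rule reach_monoS[OF w(3)]) auto
    then have wh: "reach E (- {v} - S2) w h" by (rule reach_snoc[OF _ u(2)]) (use u(3) d in auto)
    have "w \<notin> S1" "w \<notin> S3" using reach_in(1)[OF w(3)] by auto
    moreover have "s \<in> S2" using w(1) by auto
    ultimately show False using H1_ear[OF b(2) b(1) d(4) _ w(2) _ wh] H1_ear[OF b(2) b(3) d(3) _ w(2) _ wh] u(3) nH
      by blast
  qed
  have yu: "reach E (- {v} - S1) y u" by (rule reach_monoS[OF u(1)]) auto
  have "\<exists>z'\<in>S3. (u, z') \<in> E"
    using u(3) u(2) tail[OF uS _ u(2)] a23 by auto
  then obtain z' where z': "z' \<in> S3" "(u, z') \<in> E" by blast
  have "reach E (- {v} - S1) y z'" by (rule reach_snoc[OF yu z'(2)]) (use z'(1) sub d in auto)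
  then have "H1_bags E v" using H1_ear[OF b(1) b(3) d(2) a12(1,3) _ _ z'(1)] a12(2) d by blast
  then show False using nH by simp
qed

lemma out_bag_Field: "out_bag E b S q \<Longrightarrow> b \<in> Field E"
  by (auto simp: out_bag_def Field_def)

theorem H1_bags_exists:
  assumes "finite V" "E \<subseteq> V \<times> V" "irrefl E" "\<not> colorable E"
  shows "\<exists>b. H1_bags E b"
proof -
  have "\<exists>b. b \<noteq> r \<and> H1_bags E b" for r
  proof (rule rooted_induction[where HH = H1_bags, OF _ _ _ _ assms])
    show "H1_bags E b \<Longrightarrow> b \<in> Field E" for E :: "('a \<times> 'a) set" and b
      by (erule H1_bagsE) (rule out_bag_Field)
    show "H1_bags E b \<Longrightarrow> E \<subseteq> E' \<Longrightarrow> H1_bags E' b" for E E' :: "('a \<times> 'a) set" and b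
      by (rule H1_bags_mono)
    show "liftable E R v \<Longrightarrow> H1_bags (contract E R v) b \<Longrightarrow> b \<noteq> v \<Longrightarrow> H1_bags E b"
      for E :: "('a \<times> 'a) set" and R v b by (rule H1_bags_lift)
    fix V :: "'a set" and E v r
    assume *: "E \<subseteq> V \<times> V" "irrefl E" "v \<in> V" "strong E (V - {v})" "\<not> colorable E"
      "\<And>W. W \<subset> V \<Longrightarrow> colorable (Restr E W)"
    have "colorable (Restr E (V - {v}))" by (rule *(6)) (use *(3) in blast)
    then obtain p1 p2 p3 where "vpath E v p1" "vpath E v p2" "vpath E v p3"
      "set p1 \<inter> set p2 = {}" "set p1 \<inter> set p3 = {}" "set p2 \<inter> set p3 = {}"
      by (rule three_vpaths[OF *(1,2) _ *(5)])
    then show "H1_bags E v" by (rule H1_core[OF *(1,4)])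
  qed
  then show ?thesis by blast
qed

subsection \<open>The digraph \<open>H2\<close>\<close>

lemma vbagE:
  assumes "vbag E v F"
  obtains s t where "s \<in> F" "t \<in> F" "(v, s) \<in> E" "(t, v) \<in> E" "\<forall>x\<in>F. reach E F s x \<and> reach E F x t"
  using assms that unfolding vbag_def by blast

text \<open>After its first arc the path avoids the source bag as well, so it can be used next to
  the cycles of both \<open>A\<close> and \<open>C\<close>.\<close>

definition hits :: "('a \<times> 'a) set \<Rightarrow> 'a set \<Rightarrow> 'a set \<Rightarrow> 'a set \<Rightarrow> 'a set \<Rightarrow> bool" where
  "hits E G A B C \<longleftrightarrow> (\<exists>a\<in>A. \<exists>i. \<exists>y\<in>B. (a, i) \<in> E \<and> reach E (G - A - C) i y)"

lemma hitsI:
  assumes "reach E (G - C) x y" "x \<in> A" "y \<in> B" "A \<inter> B = {}"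
  shows "hits E G A B C"
proof -
  have "x \<notin> - A" "y \<in> - A" using assms by auto
  then obtain u w where u: "u \<in> (G - C) - - A" "(u, w) \<in> E" "reach E ((G - C) \<inter> - A) w y"
    by (rule reach_entry[OF assms(1)])
  have "reach E (G - A - C) w y" by (rule reach_monoS[OF u(3)]) auto
  then show ?thesis unfolding hits_def using u(1,2) assms(3) by blast
qed

lemma H2_meet:
  assumes "v \<notin> G" "vbag E v A" "vbag E v B" "A \<inter> B = {}"
    and "a \<in> A" "(a, i) \<in> E" "reach E (G - A - B) i z"
    and "b \<in> B" "(b, i') \<in> E" "reach E (G - A - B) i' z"
  shows "H2_bags E v"
proof (rule H2_bagsI[where A = A and C = B and D = "G - A - B" and q = a and q' = b and i = i and i' = i' and z = z])
  have "v \<notin> A" "v \<notin> B" using vbag_notin assms(2,3) by metis+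
  then show "v \<notin> A \<union> B \<union> (G - A - B)" using assms(1) by blast
  show "out_bag E v A a" by (rule vbag_out) fact+
  show "out_bag E v B b" by (rule vbag_out) fact+
qed (use assms in auto)

text \<open>Two such paths into \<open>C\<close> can be prolonged inside \<open>C\<close> to its
  common end \<open>t\<close>, so they join there and produce the vertex \<open>d\<close>.\<close>

lemma hits_unique:
  assumes "v \<notin> G" "vbag E v A" "vbag E v B" "vbag E v C" "A \<inter> B = {}" "A \<inter> C = {}" "B \<inter> C = {}"
    and "C \<subseteq> G" "\<not> H2_bags E v"
  shows "\<not> (hits E G A C B \<and> hits E G B C A)"
proof
  assume "hits E G A C B \<and> hits E G B C A"
  then obtain a i y b i' y' where *: "a \<in> A" "(a, i) \<in> E" "reach E (G - A - B) i y" "y \<in> C"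
    "b \<in> B" "(b, i') \<in> E" "reach E (G - B - A) i' y'" "y' \<in> C"
    unfolding hits_def by metis
  obtain t where t: "\<forall>x\<in>C. reach E C x t" using vbagE[OF assms(4)] by metis
  have CG: "C \<subseteq> G - A - B" using assms by blast
  have "reach E (G - A - B) y t" "reach E (G - A - B) y' t"
    using t *(4,8) CG reach_monoS by metis+
  moreover have "reach E (G - A - B) i' y'" using *(7) by (rule reach_monoS) blast
  ultimately have "reach E (G - A - B) i t" "reach E (G - A - B) i' t"
    using *(3) reach_trans by metis+
  then show False using H2_meet[OF assms(1-3,5) *(1,2) _ *(5,6)] assms(9) by blast
qed

text \<open>Consider the last departure from \<open>A\<close> and \<open>B\<close> on a path to
  \<open>C\<close>.\<close>

lemma hits_into:
  assumes "strong E G" "A \<noteq> {}" "C \<noteq> {}" "A \<subseteq> G" "C \<subseteq> G" "A \<inter> C = {}" "B \<inter> C = {}"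
  shows "hits E G A C B \<or> hits E G B C A"
proof -
  obtain x y where xy: "x \<in> A" "y \<in> C" using assms by blast
  then have r: "reach E G x y" using assms unfolding strong_def by blast
  have "x \<notin> - (A \<union> B)" "y \<in> - (A \<union> B)" using xy assms by auto
  then obtain u w where u: "u \<in> G - - (A \<union> B)" "(u, w) \<in> E" "reach E (G \<inter> - (A \<union> B)) w y"
    by (rule reach_entry[OF r])
  have "reach E (G - A - B) w y" "reach E (G - B - A) w y"
    by (rule reach_monoS[OF u(3)]; blast)+
  moreover have "u \<in> A \<or> u \<in> B" using u(1) by blast
  ultimately show ?thesis unfolding hits_def using u(2) xy(2) by blast
qed

text \<open>Consider the first arrival in \<open>B\<close> or \<open>C\<close> on a path from
  \<open>A\<close>.\<close>

lemma hits_out: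
  assumes "strong E G" "A \<noteq> {}" "B \<noteq> {}" "A \<subseteq> G" "B \<subseteq> G" "A \<inter> B = {}" "A \<inter> C = {}" "B \<inter> C = {}"
  shows "hits E G A B C \<or> hits E G A C B"
proof -
  obtain x y where xy: "x \<in> A" "y \<in> B" using assms by blast
  then have r: "reach E G x y" using assms unfolding strong_def by blast
  have "x \<in> - (B \<union> C)" "y \<notin> - (B \<union> C)" using xy assms by auto
  then obtain u w where u: "reach E (G \<inter> - (B \<union> C)) x u" "(u, w) \<in> E" "w \<in> G - - (B \<union> C)"
    by (rule reach_exit[OF r])
  show ?thesis
  proof (cases "w \<in> B")
    case True
    have "reach E (G - C) x u" by (rule reach_monoS[OF u(1)]) blast
    then have "reach E (G - C) x w" by (rule reach_snoc[OF _ u(2)]) (use u(3) True assms(8) in blast)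
    then show ?thesis using hitsI[OF _ xy(1) True assms(6)] by blast
  next
    case False
    then have w: "w \<in> C" using u(3) by blast
    have "reach E (G - B) x u" by (rule reach_monoS[OF u(1)]) blast
    then have "reach E (G - B) x w" by (rule reach_snoc[OF _ u(2)]) (use u(3) False in blast)
    then show ?thesis using hitsI[OF _ xy(1) w assms(7)] by blast
  qed
qed

section \<open>The three parts of the cyclic arrangement\<close>

definition reach_part :: "('a \<times> 'a) set \<Rightarrow> 'a set \<Rightarrow> 'a set \<Rightarrow> 'a set \<Rightarrow> 'a set \<Rightarrow> 'a set" where
  "reach_part E G A B C = {x. \<exists>a\<in>A. reach E (G - B - C) a x}"

lemma walk_switch: "walk E (xs @ z # ys) \<Longrightarrow> walk E (us @ z # vs) \<Longrightarrow> walk E (xs @ z # vs)"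
  by (auto simp: successively_append_iff)

lemma walk_suffix: "walk E (xs @ ys) \<Longrightarrow> walk E ys"
  by (simp add: successively_append_iff)

lemma walk_snoc: "walk E xs \<Longrightarrow> xs \<noteq> [] \<Longrightarrow> (last xs, y) \<in> E \<Longrightarrow> walk E (xs @ [y])"
  by (simp add: successively_append_iff)

text \<open>
  Without \<open>H2\<close> at \<open>v\<close>, every one of three disjoint bags is reached from exactly one other bag
  directly, so that up to symmetry they are arranged cyclically \<open>F1\<close>, \<open>F2\<close>, \<open>F3\<close>, \<open>F1\<close>.
\<close>

locale cyc3 =
  fixes E :: "('a \<times> 'a) set" and G :: "'a set" and v :: 'a and F1 F2 F3 :: "'a set"
  assumes vG: "v \<notin> G" and str: "strong E G"
    and bags: "vbag E v F1" "vbag E v F2" "vbag E v F3"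
    and sub: "F1 \<subseteq> G" "F2 \<subseteq> G" "F3 \<subseteq> G"
    and disj: "F1 \<inter> F2 = {}" "F1 \<inter> F3 = {}" "F2 \<inter> F3 = {}"
    and nH: "\<not> H2_bags E v"
    and no_hit: "\<not> hits E G F1 F3 F2" "\<not> hits E G F2 F1 F3" "\<not> hits E G F3 F2 F1"
begin

lemma rotate: "cyc3 E G v F2 F3 F1"
  by unfold_locales (use vG str bags sub disj nH no_hit in auto)

definition "R = reach_part E G F1 F2 F3"

lemma R_sub: "R \<subseteq> G - F2 - F3" "F1 \<subseteq> R"
proof -
  show "R \<subseteq> G - F2 - F3" unfolding R_def reach_part_def using reach_in(2)[of E "G - F2 - F3"] by blast
  have "F1 \<subseteq> G - F2 - F3" using sub disj by blast
  then show "F1 \<subseteq> R" unfolding R_def reach_part_def using reach_refl[of _ "G - F2 - F3" E] by blast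
qed

lemma R_reach: 
  assumes "x \<in> R"
  obtains a where "a \<in> F1" "reach E R a x"
proof -
  obtain a where a: "a \<in> F1" "reach E (G - F2 - F3) a x"
    using assms unfolding R_def reach_part_def by blast
  have "reach E R a x" using a(2)
  proof (induction rule: reach_induct)
    case refl
    then show ?case using a(1) R_sub by (intro reach_refl) blast
  next
    case (step y z)
    have "reach E (G - F2 - F3) a z" 
      using step(1) \<open>(y, z) \<in> E\<close> \<open>z \<in> G - F2 - F3\<close> by (rule reach_snoc)
    then have "z \<in> R" using a(1) unfolding R_def reach_part_def by blast
    then show ?case by (rule reach_snoc[OF step.IH \<open>(y, z) \<in> E\<close>])
  qed
  then show ?thesis using that a(1) by blast
qed

text \<open>An arc to \<open>F3\<close> would be a forbidden hit of \<open>F3\<close> from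
  \<open>F1\<close>, and an arc to a vertex outside of all bags stays in \<open>R\<close> by
  construction.\<close>

lemma R_out:
  assumes "x \<in> R" "(x, y) \<in> E" "y \<in> G"
  shows "y \<in> R \<union> F2"
proof (rule ccontr)
  assume n: "y \<notin> R \<union> F2"
  obtain a where a: "a \<in> F1" "reach E (G - F2 - F3) a x"
    using assms unfolding R_def reach_part_def by blast
  show False
  proof (cases "y \<in> F3")
    case True
    have "reach E (G - F2) a x" by (rule reach_monoS[OF a(2)]) blast
    then have "reach E (G - F2) a y" by (rule reach_snoc[OF _ assms(2)]) (use n assms in blast)
    then show False using hitsI[OF _ a(1) True disj(2)] no_hit(1) by blast
  next
    case False
    then have "y \<in> G - F2 - F3" using n assms by blast
    then have "reach E (G - F2 - F3) a y" by (rule reach_snoc[OF a(2) assms(2)])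
    then show False using n a(1) unfolding R_def reach_part_def by blast
  qed
qed

text \<open>A common vertex would be reached from \<open>F1\<close> and from \<open>F2\<close>
  beside both bags, hence would yield a join for \<open>d\<close>.\<close>

lemma R_disj: "R \<inter> reach_part E G F2 F3 F1 = {}"
proof (rule ccontr)
  assume "\<not> ?thesis"
  then obtain x a b where x: "a \<in> F1" "reach E (G - F2 - F3) a x" "b \<in> F2" "reach E (G - F3 - F1) b x"
    unfolding R_def reach_part_def by blast
  have "a \<notin> - F1" "x \<in> - F1" using x(1) reach_in(2)[OF x(4)] by auto
  then obtain u w where u: "u \<in> (G - F2 - F3) - - F1" "(u, w) \<in> E" "reach E ((G - F2 - F3) \<inter> - F1) w x"
    by (rule reach_entry[OF x(2)])
  have "b \<notin> - F2" "x \<in> - F2" using x(3) reach_in(2)[OF x(2)] by auto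
  then obtain u' w' where u': "u' \<in> (G - F3 - F1) - - F2" "(u', w') \<in> E" "reach E ((G - F3 - F1) \<inter> - F2) w' x"
    by (rule reach_entry[OF x(4)])
  have "reach E (G - F1 - F2) w x" by (rule reach_monoS[OF u(3)]) blast
  moreover have "reach E (G - F1 - F2) w' x" by (rule reach_monoS[OF u'(3)]) blast
  ultimately show False
    using H2_meet[OF vG bags(1,2) disj(1) _ u(2) _ _ u'(2)] u(1) u'(1) nH by blast
qed

lemma cover:
  assumes "x \<in> G"
  shows "x \<in> reach_part E G F1 F2 F3 \<union> reach_part E G F2 F3 F1 \<union> reach_part E G F3 F1 F2"
proof -
  obtain s where s: "s \<in> F1" using vbag_nonempty[OF bags(1)] by blast
  define B where "B = F1 \<union> F2 \<union> F3"
  \<comment> \<open>\<open>b\<close> is the last vertex in a bag on a path to \<open>x\<close>; it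
    decides the part to which \<open>x\<close> belongs.\<close>
  have "\<exists>b\<in>B. reach E (insert b (G - B)) b x"
  proof (cases "x \<in> B")
    case True
    then show ?thesis using reach_refl[of x "insert x (G - B)" E] by blast
  next
    case False
    have r: "reach E G s x" using s sub str assms unfolding strong_def by blast
    have "s \<notin> - B" "x \<in> - B" using s False by (auto simp: B_def)
    then obtain u w where u: "u \<in> G - - B" "(u, w) \<in> E" "reach E (G \<inter> - B) w x"
      by (rule reach_entry[OF r])
    have "reach E (insert u (G - B)) w x" by (rule reach_monoS[OF u(3)]) blast
    then have "reach E (insert u (G - B)) u x" by (rule reach_cons[OF u(2)]) blast
    then show ?thesis using u(1) by blast
  qed
  then obtain b where b: "b \<in> B" "reach E (insert b (G - B)) b x" by blast
  from b(1) consider "b \<in> F1" | "b \<in> F2" | "b \<in> F3" by (auto simp: B_def)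
  then show ?thesis
  proof cases
    case 1
    have "reach E (G - F2 - F3) b x"
      by (rule reach_monoS[OF b(2)]) (use 1 sub disj B_def in blast)
    then show ?thesis using 1 unfolding reach_part_def by blast
  next
    case 2
    have "reach E (G - F3 - F1) b x"
      by (rule reach_monoS[OF b(2)]) (use 2 sub disj B_def in blast)
    then show ?thesis using 2 unfolding reach_part_def by blast
  next
    case 3
    have "reach E (G - F1 - F2) b x"
      by (rule reach_monoS[OF b(2)]) (use 3 sub disj B_def in blast)
    then show ?thesis using 3 unfolding reach_part_def by blast
  qed
qed

lemma exit_arc:
  obtains u f where "u \<in> R" "f \<in> F2" "(u, f) \<in> E"
proof -
  obtain a b where ab: "a \<in> F1" "b \<in> F2"
    using vbag_nonempty[OF bags(1)] vbag_nonempty[OF bags(2)] by blast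
  then have r: "reach E G a b" using sub str unfolding strong_def by blast
  have "a \<in> - (F2 \<union> F3)" "b \<notin> - (F2 \<union> F3)" using ab disj by auto
  then obtain u w where u: "reach E (G \<inter> - (F2 \<union> F3)) a u" "(u, w) \<in> E" "w \<in> G - - (F2 \<union> F3)"
    by (rule reach_exit[OF r])
  have "reach E (G - F2 - F3) a u" by (rule reach_monoS[OF u(1)]) blast
  then have uR: "u \<in> R" using ab(1) unfolding R_def reach_part_def by blast
  then have "w \<in> F2" using R_out[OF uR u(2)] u(3) R_sub by blast
  then show ?thesis using that uR u(2) by blast
qed

interpretation rot1: cyc3 E G v F2 F3 F1 by (rule rotate)
interpretation rot2: cyc3 E G v F3 F1 F2 by (rule rot1.rotate)

abbreviation "R2 \<equiv> reach_part E G F2 F3 F1"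
abbreviation "R3 \<equiv> reach_part E G F3 F1 F2"

lemmas R2_sub = rot1.R_sub[unfolded rot1.R_def]
  and R3_sub = rot2.R_sub[unfolded rot2.R_def]
  and R2_out = rot1.R_out[unfolded rot1.R_def]
  and R2_R3_disj = rot1.R_disj[unfolded rot1.R_def]
  and R3_R_disj = rot2.R_disj[unfolded rot2.R_def, folded R_def]
  and R3_reach = rot2.R_reach[unfolded rot2.R_def]

lemma into_R:
  assumes "m \<in> G - R" "(m, e) \<in> E" "e \<in> R"
  shows "m \<in> R3"
proof (rule ccontr)
  assume "m \<notin> R3"
  then have "m \<in> R2" using cover[of m] assms(1) unfolding R_def by blast
  then have "e \<in> R2 \<union> F3" using R2_out[OF _ assms(2)] assms(3) R_sub(1) by blast
  then show False using assms(3) R_disj R_sub(1) by blast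
qed

text \<open>
  A path \<open>ps\<close> from \<open>v\<close> to \<open>X\<close> that splits into a path \<open>ts\<close> back to \<open>v\<close> and a path \<open>ws\<close>
  leaving \<open>R\<close>. If \<open>ps\<close> is as short as possible, then every path that traverses \<open>R\<close> goes
  through \<open>X\<close>.
\<close>

definition tripod :: "'a list \<Rightarrow> 'a \<Rightarrow> 'a list \<Rightarrow> 'a list \<Rightarrow> bool" where
  "tripod ps X ts ws \<longleftrightarrow> walk E (ps @ X # ts) \<and> walk E (X # ws) \<and> distinct (ps @ X # ts @ ws) \<and>
     set (ps @ X # ts @ ws) \<subseteq> R \<and> (v, hd (ps @ [X])) \<in> E \<and> (last (X # ts), v) \<in> E \<and>
     (\<exists>f\<in>F2. (last (X # ws), f) \<in> E)"

text \<open>The cycle bag \<open>F1\<close> gives the way from \<open>v\<close> and back, an arc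
  from \<open>R\<close> to \<open>F2\<close> gives the exit, and the fork of the two routes from
  \<open>s\<close> is \<open>X\<close>.\<close>

lemma tripod_exists: "\<exists>ps X ts ws. tripod ps X ts ws"
proof -
  obtain s t where st: "s \<in> F1" "t \<in> F1" "(v, s) \<in> E" "(t, v) \<in> E" "\<forall>x\<in>F1. reach E F1 s x \<and> reach E F1 x t"
    using vbagE[OF bags(1)] .
  obtain u f where u: "u \<in> R" "f \<in> F2" "(u, f) \<in> E" by (rule exit_arc)
  obtain a where a: "a \<in> F1" "reach E R a u" using R_reach[OF u(1)] .
  have "reach E F1 s t" "reach E F1 s a" using st a(1) by blast+
  then have rt: "reach E R s t" and "reach E R s a" using R_sub(2) by (auto elim: reach_monoS)
  then have ru: "reach E R s u" using a(2) by (blast intro: reach_trans)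
  obtain ps X ts qs where *: "walk E (ps @ X # ts)" "walk E (X # qs)" "distinct (ps @ X # ts @ qs)"
    "set (ps @ X # ts @ qs) \<subseteq> R" "hd (ps @ [X]) = s" "last (X # ts) = t" "last (X # qs) = u"
    by (rule reach_fork[OF rt ru])
  have "\<exists>f\<in>F2. (last (X # qs), f) \<in> E" using *(7) u by metis
  moreover have "(v, hd (ps @ [X])) \<in> E" using st(3) unfolding *(5) .
  moreover have "(last (X # ts), v) \<in> E" using st(4) unfolding *(6) .
  ultimately have "tripod ps X ts qs" using *(1-4) unfolding tripod_def by (intro conjI)
  then show ?thesis by blast
qed

text \<open>An exit that branches off before \<open>X\<close> and avoids \<open>X\<close> lets
  \<open>u\<close> take over as centre, and \<open>u\<close> has a shorter path from
  \<open>v\<close>.\<close>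

lemma tripod_reroute:
  assumes c: "tripod ps X ts ws" and u: "u \<in> set ps" and q: "walk E (u # qs)" "distinct qs"
    "set qs \<subseteq> R - {X} - set ps" and g: "(last (u # qs), g) \<in> E" "g \<in> F2"
  shows "\<exists>ps' X' ts' ws'. tripod ps' X' ts' ws' \<and> length ps' < length ps"
proof -
  have cs: "walk E (ps @ X # ts)" "walk E (X # ws)" "distinct (ps @ X # ts @ ws)" 
     "set (ps @ X # ts @ ws) \<subseteq> R" "(v, hd (ps @ [X])) \<in> E" "(last (X # ts), v) \<in> E"
    using c by (simp_all only: tripod_def)
  obtain f where f: "f \<in> F2" "(last (X # ws), f) \<in> E" using c unfolding tripod_def by metis
  obtain a b where ab: "ps = a @ u # b" using u by (meson split_list)
  have hd: "hd (a @ [u]) = hd (ps @ [X])" using ab by (cases a) auto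
  have w1: "walk E (a @ u # (b @ X # ts))" using cs(1) ab by simp
  have w2: "walk E ((u # b) @ X # ts)" using walk_suffix[OF w1] by simp
  have w3: "walk E ((u # b) @ X # ws)" using walk_switch[OF w2, of "[]" ws] cs(2) by simp
  have d: "distinct (a @ u # (b @ X # ts) @ ws)" using cs(3) ab by simp
  have sR: "set (a @ u # (b @ X # ts) @ ws) \<subseteq> R" using cs(4) ab by simp
  have dq: "distinct qs" "set qs \<inter> set (a @ u # b @ [X]) = {}" "set qs \<subseteq> R" using q(2,3) ab by auto
  have len: "length a < length ps" using ab by simp
  show ?thesis
  proof (cases "\<exists>z\<in>set qs. z \<in> set ts \<union> set ws")
    case False
    \<comment> \<open>The detour misses both legs: the old route back to \<open>v\<close> stays, and
      the detour is the new exit.\<close>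
    have "tripod a u (b @ X # ts) qs"
      unfolding tripod_def
    proof (intro conjI)
      show "walk E (a @ u # (b @ X # ts))" by (fact w1)
      show "walk E (u # qs)" by (fact q(1))
      show "distinct (a @ u # (b @ X # ts) @ qs)" using d dq False by auto
      show "set (a @ u # (b @ X # ts) @ qs) \<subseteq> R" using sR dq by auto
      show "(v, hd (a @ [u])) \<in> E" using hd cs(5) by simp
      show "(last (u # b @ X # ts), v) \<in> E" using cs(6) by simp
      show "\<exists>f\<in>F2. (last (u # qs), f) \<in> E" using g by blast
    qed
    then show ?thesis using len by blast
  next
    case True
    then obtain q1 z q2 where z: "qs = q1 @ z # q2" "z \<in> set ts \<union> set ws" "\<forall>y\<in>set q1. y \<notin> set ts \<union> set ws"
      using split_list_first_prop[of qs "\<lambda>z. z \<in> set ts \<union> set ws"] by blast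
    have wq: "walk E ((u # q1) @ z # q2)" using q(1) z(1) by simp
    show ?thesis
    proof (cases "z \<in> set ts")
      case True
      then obtain t1 t2 where t: "ts = t1 @ z # t2" by (meson split_list)
      have "walk E ((ps @ X # t1) @ z # t2)" using cs(1) t by simp
      then have w4: "walk E ((u # q1) @ z # t2)" by (rule walk_switch[OF wq])
      \<comment> \<open>The detour first meets the leg back to \<open>v\<close>, so the roles
        change: it becomes the way back, and the old route through \<open>X\<close> becomes the
        exit.\<close>
      have "tripod a u (q1 @ z # t2) (b @ X # ws)"
        unfolding tripod_def
      proof (intro conjI)
        show "walk E (a @ u # q1 @ z # t2)" using walk_switch[OF w1, of "[]" "q1 @ z # t2"] w4 by simp
        show "walk E (u # b @ X # ws)" using w3 by simp
        show "distinct (a @ u # (q1 @ z # t2) @ b @ X # ws)" using d dq z t by auto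
        show "set (a @ u # (q1 @ z # t2) @ b @ X # ws) \<subseteq> R" using sR dq z t by auto
        show "(v, hd (a @ [u])) \<in> E" using hd cs(5) by simp
        show "(last (u # q1 @ z # t2), v) \<in> E" using cs(6) t by simp
        show "\<exists>f\<in>F2. (last (u # b @ X # ws), f) \<in> E" using f by auto
      qed
      then show ?thesis using len by blast
    next
      case False
      then obtain t1 t2 where t: "ws = t1 @ z # t2" using z(2) by (meson split_list Un_iff)
      have "walk E ((X # t1) @ z # t2)" using cs(2) t by simp
      then have w4: "walk E ((u # q1) @ z # t2)" by (rule walk_switch[OF wq])
      \<comment> \<open>The detour first meets the exit leg and follows it from there.\<close>
      have "tripod a u (b @ X # ts) (q1 @ z # t2)"
        unfolding tripod_def
      proof (intro conjI)
        show "walk E (a @ u # (b @ X # ts))" by (fact w1)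
        show "walk E (u # q1 @ z # t2)" using w4 by simp
        show "distinct (a @ u # (b @ X # ts) @ q1 @ z # t2)" using d dq z t by auto
        show "set (a @ u # (b @ X # ts) @ q1 @ z # t2) \<subseteq> R" using sR dq z t by auto
        show "(v, hd (a @ [u])) \<in> E" using hd cs(5) by simp
        show "(last (u # b @ X # ts), v) \<in> E" using cs(6) by simp
        show "\<exists>f\<in>F2. (last (u # q1 @ z # t2), f) \<in> E" using f t by auto
      qed
      then show ?thesis using len by blast
    qed
  qed
qed

text \<open>A traversal of \<open>R\<close> that misses \<open>X\<close> and \<open>ps\<close>
  starts from \<open>F3\<close> beside the tripod. With \<open>F3\<close> as one bag and
  \<open>X\<close> as the exit of the other, it can be joined to a leg of the tripod, or in
  \<open>F2\<close>, to give \<open>H2\<close> at \<open>v\<close>.\<close>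

lemma tripod_avoided:
  assumes c: "tripod ps X ts ws" and m: "m \<in> R3" "(m, e) \<in> E"
    and r: "reach E (R - {X} - set ps) e u" and g: "(u, g) \<in> E" "g \<in> F2"
  shows False
proof -
  have cs: "walk E (ps @ X # ts)" "walk E (X # ws)" "distinct (ps @ X # ts @ ws)" 
     "set (ps @ X # ts @ ws) \<subseteq> R" "(v, hd (ps @ [X])) \<in> E" "(last (X # ts), v) \<in> E"
    using c by (simp_all only: tripod_def)
  obtain f where f: "f \<in> F2" "(last (X # ws), f) \<in> E" using c unfolding tripod_def by metis
  obtain t2 where t2: "t2 \<in> F2" "(t2, v) \<in> E" "\<forall>x\<in>F2. reach E F2 x t2"
    using vbagE[OF bags(2)] by metis
  obtain b where b: "b \<in> F3" "reach E R3 b m" using R3_reach[OF m(1)] .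
  define D where "D = R3 \<union> (R - {X} - set ps - set ts - set ws)"
  have sep: "R \<inter> R3 = {}" "R \<inter> F2 = {}" "R \<inter> F3 = {}" "R3 \<inter> F2 = {}" "R3 \<subseteq> G" "R \<subseteq> G" "F3 \<subseteq> R3"
    using R3_R_disj R_sub R3_sub by auto
  \<comment> \<open>\<open>z\<close> is the first contact of the route from \<open>F3\<close> with
    the legs, or its arrival in \<open>F2\<close>. Which leg is met decides which one closes the
    cycle through \<open>v\<close>.\<close>
  obtain z where z: "z \<in> set ts \<union> set ws \<union> {g}" "reach E (insert z D) b z"
  proof -
    define D0 where "D0 = insert g (R3 \<union> (R - {X} - set ps))"
    have "reach E D0 b m" by (rule reach_monoS[OF b(2)]) (auto simp: D0_def)
    moreover have "reach E D0 e u" by (rule reach_monoS[OF r]) (auto simp: D0_def)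
    ultimately have "reach E D0 b u" using m(2) by (meson reach_cons reach_in(2) reach_trans)
    then have r0: "reach E D0 b g" by (rule reach_snoc[OF _ g(1)]) (simp add: D0_def)
    let ?T = "- (set ts \<union> set ws \<union> {g})"
    have "b \<notin> R" "b \<noteq> g" using b(1) g(2) sep by auto
    then have "b \<in> ?T" "g \<notin> ?T" using cs(4) by auto
    then obtain p z where p: "reach E (D0 \<inter> ?T) b p" "(p, z) \<in> E" "z \<in> D0 - ?T"
      by (rule reach_exit[OF r0])
    have "reach E (insert z D) b p" by (rule reach_monoS[OF p(1)]) (auto simp: D0_def D_def)
    then have "reach E (insert z D) b z" by (rule reach_snoc[OF _ p(2)]) simp
    then show ?thesis using that p(3) by blast
  qed
  have zF3: "z \<notin> F3" using z(1) cs(4) sep g(2) disj by auto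
  then have "b \<notin> - F3" "z \<in> - F3" using b(1) by auto
  then obtain p w where p: "p \<in> insert z D - - F3" "(p, w) \<in> E" "reach E (insert z D \<inter> - F3) w z"
    by (rule reach_entry[OF z(2)])
  have bag3: "out_bag E v F3 p" using vbag_out[OF bags(3)] p(1) by blast
  have sepv: "v \<notin> F3" "v \<notin> F2" "v \<notin> R" "v \<notin> R3" using vG sub R_sub R3_sub by auto
  have gf: "reach E F2 g t2" "reach E F2 f t2" using t2(3) g(2) f(1) by blast+
  have wf: "walk E (X # ws @ [f])" using walk_snoc[OF cs(2) _ f(2)] by simp
  have toF: "reach E (set ws \<union> F2) y t2" if y: "y \<in> set (ws @ [f])" for y
  proof -
    have "walk E ((ws @ [f]) @ [])" using walk_suffix[of E "[X]" "ws @ [f]"] wf by simp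
    from walk_reach_last[OF this y order_refl] have "reach E (set (ws @ [f])) y f" by simp
    then have "reach E (set ws \<union> F2) y f" by (rule reach_monoS) (use f(1) in auto)
    moreover have "reach E (set ws \<union> F2) f t2" using gf(2) by (rule reach_monoS) auto
    ultimately show ?thesis by (rule reach_trans)
  qed
  show False
  proof (cases "z \<in> set ts")
    case False
    \<comment> \<open>The leg \<open>ts\<close> is free, so it closes the cycle; the route from
      \<open>X\<close> along \<open>ws\<close> and the route from \<open>F3\<close> meet in
      \<open>F2\<close> at the latest.\<close>
    have "vpath E v (ps @ X # ts)"
      unfolding vpath_def using cs sepv by (cases ps) auto
    then have out: "out_bag E v (set (ps @ X # ts)) X" by (intro vbag_out[OF vpath_vbag]) auto
    define K where "K = (insert z D \<inter> - F3) \<union> set ws \<union> F2"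
    have zt: "reach E (set ws \<union> F2) z t2"
    proof (cases "z \<in> set ws")
      case True
      then show ?thesis using toF by simp
    next
      case zw: False
      then have "z = g" using z(1) False by blast
      then show ?thesis using gf(1) by (auto elim: reach_monoS)
    qed
    have "reach E K w z" by (rule reach_monoS[OF p(3)]) (auto simp: K_def)
    moreover have "reach E K z t2" by (rule reach_monoS[OF zt]) (auto simp: K_def)
    ultimately have wt: "reach E K w t2" by (rule reach_trans)
    have "(X, hd (ws @ [f])) \<in> E" using wf by (cases ws) auto
    moreover have "hd (ws @ [f]) \<in> set (ws @ [f])" by (cases ws) auto
    then have "reach E (set ws \<union> F2) (hd (ws @ [f])) t2" by (rule toF)
    then have "reach E K (hd (ws @ [f])) t2" by (rule reach_monoS) (auto simp: K_def)
    moreover have zz: "z \<in> set ws \<union> {g}" using z(1) False by blast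
    have "v \<notin> set (ps @ X # ts) \<union> F3 \<union> K"
      using sepv cs(4) zz g(2) by (auto simp: K_def D_def)
    moreover have "set (ps @ X # ts) \<inter> F3 = {}" using cs(4) sep by auto
    moreover have "set (ps @ X # ts) \<inter> K = {}"
    proof -
      have "set (ps @ X # ts) \<inter> D = {}" using cs(4) sep(1) by (auto simp: D_def)
      moreover have "set (ps @ X # ts) \<inter> set ws = {}" using cs(3) by auto
      moreover have "set (ps @ X # ts) \<inter> F2 = {}" using cs(4) sep by auto
      ultimately show ?thesis using zz g(2) unfolding K_def by blast
    qed
    moreover have "F3 \<inter> K = {}" using cs(4) sep disj by (auto simp: K_def)
    ultimately have "H2_bags E v" by (intro H2_bagsI[OF _ _ _ _ out _ _ bag3 p(2) wt])
    then show False using nH by simp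
  next
    case True
    then obtain ta tb where tt: "ts = ta @ z # tb" by (meson split_list)
    \<comment> \<open>Now \<open>ts\<close> carries the join at \<open>z\<close>, so the cycle
      through \<open>v\<close> must return over \<open>ws\<close> and the end \<open>t2\<close> of
      \<open>F2\<close>.\<close>
    define A where "A = set (ps @ X # ws) \<union> F2"
    define K where "K = (insert z D \<inter> - F3) \<union> set ts"
    have "out_bag E v A X"
      unfolding out_bag_def
    proof (rule exI[of _ "hd (ps @ [X])"], rule exI[of _ t2], intro conjI)
      let ?s = "hd (ps @ [X])"
      show "(v, ?s) \<in> E" by (fact cs(5))
      have "walk E ((ps @ [X]) @ ts)" using cs(1) by simp
      moreover have "?s \<in> set (ps @ [X])" by (cases ps) auto
      ultimately have "reach E (set (ps @ [X])) ?s X"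
        using walk_reach_last[of E "ps @ [X]" ts ?s] by auto
      then show sX: "reach E A ?s X" by (rule reach_monoS) (auto simp: A_def)
      have "(X, hd (ws @ [f])) \<in> E" using wf by (cases ws) auto
      moreover have "hd (ws @ [f]) \<in> set (ws @ [f])" by (cases ws) auto
      then have "reach E (set ws \<union> F2) (hd (ws @ [f])) t2" by (rule toF)
      then have "reach E A (hd (ws @ [f])) t2" by (rule reach_monoS) (auto simp: A_def)
      ultimately have "reach E A X t2" by (rule reach_cons) (simp add: A_def)
      with sX show "reach E A ?s t2" by (rule reach_trans)
      show "(t2, v) \<in> E" by (fact t2(2))
    qed
    moreover have wX: "walk E (X # ts)" using walk_suffix[OF cs(1)] .
    have "(X, hd ts) \<in> E" using wX unfolding tt by (cases ta) auto
    moreover have "reach E K (hd ts) z"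
    proof -
      obtain h hs where h: "ts = h # hs" using True by (cases ts) auto
      have "walk E ([X] @ h # hs)" using wX h by simp
      from walk_reach[OF this, of z "set ts"] True h have "reach E (set ts) h z" by simp
      then show ?thesis unfolding h list.sel by (rule reach_monoS) (auto simp: K_def h)
    qed
    moreover have "reach E K w z" by (rule reach_monoS[OF p(3)]) (auto simp: K_def)
    moreover have "v \<notin> A \<union> F3 \<union> K"
      using sepv cs(4) True by (auto simp: K_def D_def A_def)
    moreover have "A \<inter> F3 = {}" using cs(4) sep disj by (auto simp: A_def)
    moreover have "A \<inter> K = {}"
    proof -
      have "set (ps @ X # ws) \<inter> D = {}" using cs(4) sep(1) by (auto simp: D_def)
      moreover have "set (ps @ X # ws) \<inter> set ts = {}" using cs(3) by auto
      moreover have "set ts \<inter> F2 = {}" using cs(4) sep by auto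
      moreover have "D \<inter> F2 = {}" using sep by (auto simp: D_def)
      ultimately show ?thesis using True unfolding K_def A_def by blast
    qed
    moreover have "F3 \<inter> K = {}" using cs(4) sep by (auto simp: K_def)
    ultimately have "H2_bags E v" by (intro H2_bagsI[where A = A and C = F3 and D = K, OF _ _ _ _ _ _ _ bag3 p(2)])
    then show False using nH by simp
  qed
qed

text \<open>\<open>X\<close> is the centre of a tripod with shortest \<open>ps\<close>. A traversal
  that avoids \<open>X\<close> either avoids \<open>ps\<close> too, which gives \<open>H2\<close>,
  or leaves \<open>ps\<close> for the last time at some \<open>y\<close>, which gives a shorter
  tripod.\<close>

lemma cut_vertex:
  obtains X where "X \<in> R"
    "\<forall>m\<in>G - R. \<forall>e u. \<forall>g\<in>G - R. (m, e) \<in> E \<longrightarrow> (u, g) \<in> E \<longrightarrow> \<not> reach E (R - {X}) e u"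
proof -
  have "\<exists>n ps X ts ws. tripod ps X ts ws \<and> length ps = n" using tripod_exists by blast
  then obtain n where n: "\<exists>ps X ts ws. tripod ps X ts ws \<and> length ps = n"
    "\<forall>k<n. \<not> (\<exists>ps X ts ws. tripod ps X ts ws \<and> length ps = k)"
    using exists_least_iff[of "\<lambda>n. \<exists>ps X ts ws. tripod ps X ts ws \<and> length ps = n"] by blast
  then obtain ps X ts ws where c: "tripod ps X ts ws"
    "\<And>ps' X' ts' ws'. tripod ps' X' ts' ws' \<Longrightarrow> length ps' < length ps \<Longrightarrow> False"
    by metis
  have XR: "X \<in> R" using c(1) by (auto simp: tripod_def)
  have "False" if m: "m \<in> G - R" "(m, e) \<in> E" and r: "reach E (R - {X}) e u" and g: "(u, g) \<in> E" "g \<in> G - R"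
    for m e u g
  proof -
    have eR: "e \<in> R" "u \<in> R" using reach_in[OF r] by auto
    have m3: "m \<in> R3" using into_R[OF m eR(1)] .
    have gF: "g \<in> F2" using R_out[OF eR(2) g(1)] g(2) by blast
    show False
    proof (cases "\<exists>z\<in>set ps. reach E (R - {X}) z u")
      case False
      then have "\<not> (\<exists>z\<in>R - {X} - - set ps. reach E (R - {X}) e z \<and> reach E (R - {X}) z u)" by blast
      then have "reach E ((R - {X}) \<inter> - set ps) e u" using reach_split[OF r] by blast
      then have "reach E (R - {X} - set ps) e u" by (rule reach_monoS) blast
      then show False using tripod_avoided[OF c(1) m3 m(2) _ g(1) gF] by blast
    next
      case True
      then obtain z where z: "z \<in> set ps" "reach E (R - {X}) z u" by blast
      have "reach E (insert g (R - {X})) z u" by (rule reach_monoS[OF z(2)]) blast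
      then have zg: "reach E (insert g (R - {X})) z g" by (rule reach_snoc[OF _ g(1)]) blast
      have "set ps \<subseteq> R" using c(1) by (auto simp: tripod_def)
      then have "z \<notin> - set ps" "g \<in> - set ps" using z g by auto
      then obtain y w where y: "y \<in> insert g (R - {X}) - - set ps" "(y, w) \<in> E"
        "reach E (insert g (R - {X}) \<inter> - set ps) w g" by (rule reach_entry[OF zg])
      obtain xs where xs: "walk E (w # xs)" "distinct (w # xs)" "set (w # xs) \<subseteq> insert g (R - {X}) \<inter> - set ps"
        "last (w # xs) = g" using reach_walk[OF y(3)] .
      define qs where "qs = butlast (w # xs)"
      have wq: "w # xs = qs @ [g]" using xs(4) unfolding qs_def by (metis append_butlast_last_id list.distinct(1))
      have "walk E (y # w # xs)" using xs(1) y(2) by simp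
      then have walk: "walk E ((y # qs) @ [g])" unfolding wq by simp
      have q1: "walk E (y # qs)" "(last (y # qs), g) \<in> E"
        using walk successively_append_iff[of _ "y # qs" "[g]"] by auto
      have q2: "distinct qs" "set qs \<subseteq> R - {X} - set ps"
        using xs(2,3) unfolding wq by auto
      have "y \<in> set ps" using y(1) by blast
      from tripod_reroute[OF c(1) this q1(1) q2 q1(2) gF] show False using c(2) by blast
    qed
  qed
  then show ?thesis using that XR by blast
qed

end

context cyc3
begin

subsubsection \<open>Colouring the parts\<close>

text \<open>Arcs from \<open>R\<close> to other vertices of \<open>G\<close> end in
  \<open>F2\<close>, whose cycle leads on to \<open>v\<close>; arcs into \<open>R\<close> from other
  vertices of \<open>G\<close> start in \<open>R3\<close>, which \<open>v\<close> reaches through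
  the cycle of \<open>F3\<close>.\<close>

lemma contract_liftable:
  assumes E: "E \<subseteq> insert v G \<times> insert v G"
  shows "liftable E R v"
  unfolding liftable_def
proof (intro conjI ballI allI impI)
  show vR: "v \<notin> R" using vG R_sub by blast
  then have vv: "reach E (- R) v v" by (intro reach_refl) simp
  fix u m assume u: "u \<in> R" "m \<notin> R"
  {
    assume um: "(u, m) \<in> E"
    show "reach E (- R) m v"
    proof (cases "m = v")
      case False
      then have "m \<in> F2" using R_out[OF u(1) um] um u E by blast
      obtain s t where t: "s \<in> F2" "t \<in> F2" "(v, s) \<in> E" "(t, v) \<in> E" "\<forall>x\<in>F2. reach E F2 s x \<and> reach E F2 x t"
        using vbagE[OF bags(2)] .
      have "reach E F2 m t" using t(5) \<open>m \<in> F2\<close> by blast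
      then have "reach E (- R) m t" by (rule reach_monoS) (use R_sub in blast)
      then show ?thesis by (rule reach_snoc[OF _ t(4)]) (use vR in simp)
    qed (use vv in simp)
  next
    assume mu: "(m, u) \<in> E"
    show "reach E (- R) v m"
    proof (cases "m = v")
      case False
      then have "m \<in> R3" using into_R[OF _ mu u(1)] mu u E by blast
      then obtain a where a: "a \<in> F3" "reach E R3 a m" by (rule R3_reach)
      obtain s t where t: "s \<in> F3" "t \<in> F3" "(v, s) \<in> E" "(t, v) \<in> E" "\<forall>x\<in>F3. reach E F3 s x \<and> reach E F3 x t"
        using vbagE[OF bags(3)] .
      have "reach E F3 s a" using t(5) a(1) by blast
      then have "reach E (- R) s a" by (rule reach_monoS) (use R_sub in blast)
      moreover have "reach E (- R) a m" using a(2) by (rule reach_monoS) (use R3_R_disj in blast)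
      ultimately have "reach E (- R) s m" by (rule reach_trans)
      then show ?thesis by (rule reach_cons[OF t(3)]) (use vR in simp)
    qed (use vv in simp)
  }
qed

text \<open>A bad cycle in a colour other than that of \<open>v\<close> must contain both cut
  vertices \<open>X1\<close> and \<open>X2\<close>, so it suffices to give these two no common
  colour except that of \<open>v\<close>.\<close>

lemma colorable_parts:
  assumes E: "E \<subseteq> insert v G \<times> insert v G"
    and col: "colorable (contract E R v)" "colorable (Restr E (insert v (G - R)))"
  shows "colorable E"
proof -
  interpret rot1: cyc3 E G v F2 F3 F1 by (rule rotate)
  obtain X1 where X1: "X1 \<in> R"
    "\<forall>m\<in>G - R. \<forall>e u. \<forall>g\<in>G - R. (m, e) \<in> E \<longrightarrow> (u, g) \<in> E \<longrightarrow> \<not> reach E (R - {X1}) e u"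
    by (rule cut_vertex)
  obtain X2 where X2: "X2 \<in> R2"
    "\<forall>m\<in>G - R2. \<forall>e u. \<forall>g\<in>G - R2. (m, e) \<in> E \<longrightarrow> (u, g) \<in> E \<longrightarrow> \<not> reach E (R2 - {X2}) e u"
    by (rule rot1.cut_vertex[unfolded rot1.R_def])
  obtain c0 :: "'a \<Rightarrow> nat" where c0: "range c0 \<subseteq> {..<3}" "acyclic (mono_arcs c0 (contract E R v))" "c0 v = 0"
    by (rule colorable_perm[OF col(1), of 0 v]) auto
  obtain c2 :: "'a \<Rightarrow> nat" where c2: "range c2 \<subseteq> {..<3}" "acyclic (mono_arcs c2 (Restr E (insert v (G - R))))" "c2 v = 0"
    by (rule colorable_perm[OF col(2), of 0 v]) auto
  \<comment> \<open>If \<open>X1\<close> and \<open>X2\<close> share a nonzero colour, swapping 1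
    and 2 on the side of \<open>R\<close> separates them without touching the colour 0 of
    \<open>v\<close>.\<close>
  obtain c1 :: "'a \<Rightarrow> nat" where c1: "range c1 \<subseteq> {..<3}" "acyclic (mono_arcs c1 (contract E R v))" "c1 v = 0"
    and ne: "c1 X1 = c2 X2 \<Longrightarrow> c2 X2 = 0"
  proof (cases "c0 X1 = c2 X2 \<and> c2 X2 \<noteq> 0")
    case False
    show ?thesis by (rule that[OF c0]) (use False in blast)
  next
    case True
    let ?f = "Transposition.transpose 1 (2::nat)"
    have "inj ?f" by simp
    then have "mono_arcs (?f \<circ> c0) (contract E R v) = mono_arcs c0 (contract E R v)"
      by (simp add: mono_arcs_def inj_eq)
    moreover have lt: "c0 x < 3" for x using c0(1) by blast
    then have "range (?f \<circ> c0) \<subseteq> {..<3}"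
      by (auto simp: Transposition.transpose_def image_subset_iff)
    moreover have "(?f \<circ> c0) v = 0" using c0(3) by (simp add: Transposition.transpose_def)
    moreover have "(?f \<circ> c0) X1 \<noteq> c2 X2"
    proof -
      have "c0 X1 = 1 \<or> c0 X1 = 2" using lt[of X1] True by linarith
      then show ?thesis using True by (auto simp: Transposition.transpose_def)
    qed
    ultimately show ?thesis using that[of "?f \<circ> c0"] c0(2) by metis
  qed
  have RG: "R \<subseteq> G" using R_sub by blast
  have EM: "E \<subseteq> insert v (R \<union> (G - R)) \<times> insert v (R \<union> (G - R))" using E RG by blast
  have vR: "v \<notin> R" "v \<notin> G - R" using vG RG by auto
  have dis: "R \<inter> (G - R) = {}" by blast
  have "acyclic (mono_arcs (\<lambda>x. if x \<in> insert v R then c1 x else c2 x) E)"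
  proof (rule acyclic_mono_combine[OF EM dis vR c1(2) c2(2)])
    show "c1 v = c2 v" using c1(3) c2(3) by simp
    fix i a e z b a' e' z' b'
    assume i: "i \<noteq> c1 v"
      and r: "a \<in> G - R" "(a, e) \<in> E" "reach E (R \<inter> {z. c1 z = i}) e z" "(z, b) \<in> E" "b \<in> G - R"
      and m: "a' \<in> R" "(a', e') \<in> E" "reach E ((G - R) \<inter> {z. c2 z = i}) e' z'" "(z', b') \<in> E" "b' \<in> R"
    have i1: "c1 X1 = i"
    proof (rule ccontr)
      assume "c1 X1 \<noteq> i"
      then have "reach E (R - {X1}) e z" by (intro reach_monoS[OF r(3)]) blast
      then show False using X1(2) r by blast
    qed
    \<comment> \<open>A segment through \<open>G - R\<close> starts in \<open>F2\<close>, thus in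
      \<open>R2\<close>, and ends in \<open>R3\<close>, so it traverses \<open>R2\<close> completely
      and meets \<open>X2\<close>.\<close>
    have e': "e' \<in> G - R" "z' \<in> G - R" using reach_in[OF m(3)] by auto
    then have "e' \<in> F2" using R_out[OF m(1,2)] by blast
    then have eR2: "e' \<in> R2" using R2_sub by blast
    have "z' \<in> R3" using into_R[OF e'(2) m(4,5)] .
    then have "z' \<notin> R2" using R2_R3_disj by blast
    then obtain u w where u: "reach E (((G - R) \<inter> {z. c2 z = i}) \<inter> R2) e' u" "(u, w) \<in> E"
      "w \<in> ((G - R) \<inter> {z. c2 z = i}) - R2" by (rule reach_exit[OF m(3) eR2])
    have i2: "c2 X2 = i"
    proof (rule ccontr)
      assume "c2 X2 \<noteq> i"
      then have "reach E (R2 - {X2}) e' u" by (intro reach_monoS[OF u(1)]) blast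
      moreover have "a' \<in> G - R2" using m(1) RG R_disj by blast
      ultimately show False using X2(2) m(2) u(2,3) by blast
    qed
    show False using ne i1 i2 i c1(3) by simp
  qed
  moreover have "range (\<lambda>x. if x \<in> insert v R then c1 x else c2 x) \<subseteq> {..<3}"
    using c1(1) c2(1) by (auto simp: image_subset_iff)
  ultimately show ?thesis by (intro colorableI)
qed

lemma not_minimal_if_root_outside:
  assumes "E \<subseteq> V \<times> V" "v \<in> V" "G = V - {v}" "\<not> colorable E" "r \<notin> R"
    and "\<And>W. W \<subset> V \<Longrightarrow> colorable (Restr E W)"
    and "\<And>R. R \<subset> V - {v} \<Longrightarrow> r \<notin> R \<Longrightarrow> liftable E R v \<Longrightarrow> colorable (contract E R v)"
  shows False
proof -
  have V: "V = insert v G" using assms(2,3) by blast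
  have EG: "E \<subseteq> insert v G \<times> insert v G" using assms(1) unfolding V .
  have ne: "F1 \<noteq> {}" "F2 \<noteq> {}" by (rule vbag_nonempty[OF bags(1)], rule vbag_nonempty[OF bags(2)])
  have "R \<subset> G" using R_sub(1) ne(2) sub(2) by blast
  then have "R \<subset> V - {v}" unfolding assms(3) .
  then have 1: "colorable (contract E R v)" by (rule assms(7)[OF _ assms(5) contract_liftable[OF EG]])
  obtain x where "x \<in> F1" using ne(1) by blast
  then have "x \<in> G" "x \<notin> insert v (G - R)" using R_sub(2) sub(1) vG by auto
  then have "insert v (G - R) \<subset> V" unfolding V by blast
  then have 2: "colorable (Restr E (insert v (G - R)))" by (rule assms(6))
  show False using colorable_parts[OF EG 1 2] assms(4) by simp
qed

text \<open>\<open>R\<close> and \<open>R2\<close> are disjoint, so at least one of them avoids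
  \<open>r\<close>; in the second case the arrangement is rotated by one.\<close>

lemma not_minimal:
  assumes "E \<subseteq> V \<times> V" "v \<in> V" "G = V - {v}" "\<not> colorable E"
    and "\<And>W. W \<subset> V \<Longrightarrow> colorable (Restr E W)"
    and "\<And>R. R \<subset> V - {v} \<Longrightarrow> r \<notin> R \<Longrightarrow> liftable E R v \<Longrightarrow> colorable (contract E R v)"
  shows False
proof (cases "r \<in> R")
  case False
  show ?thesis by (rule not_minimal_if_root_outside[OF assms(1-4) False assms(5,6)])
next
  case True
  interpret rot1: cyc3 E G v F2 F3 F1 by (rule rotate)
  have nr: "r \<notin> rot1.R" using True R_disj unfolding rot1.R_def by blast
  show ?thesis by (rule rot1.not_minimal_if_root_outside[OF assms(1-4) nr assms(5,6)])
qed

end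

text \<open>Each bag is hit from exactly one other bag and hits at least one. Three hits in all
  leave exactly one per source, and a permutation of three bags without fixed points is one of the
  two cyclic orders.\<close>

lemma H2_core:
  assumes E: "E \<subseteq> V \<times> V" and v: "v \<in> V" and str: "strong E (V - {v})" and nc: "\<not> colorable E"
    and p: "vpath E v p1" "vpath E v p2" "vpath E v p3"
    and d: "set p1 \<inter> set p2 = {}" "set p1 \<inter> set p3 = {}" "set p2 \<inter> set p3 = {}"
    and ih: "\<And>W. W \<subset> V \<Longrightarrow> colorable (Restr E W)"
      "\<And>R. R \<subset> V - {v} \<Longrightarrow> r \<notin> R \<Longrightarrow> liftable E R v \<Longrightarrow> colorable (contract E R v)"
  shows "H2_bags E v"
proof (rule ccontr)
  assume nH: "\<not> ?thesis"
  define G F1 F2 F3 where G: "G = V - {v}" and F: "F1 = set p1" "F2 = set p2" "F3 = set p3"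
  have vG: "v \<notin> G" and strG: "strong E G" using str by (auto simp: G)
  have b: "vbag E v F1" "vbag E v F2" "vbag E v F3" using p by (simp_all add: F vpath_vbag)
  have ne: "F1 \<noteq> {}" "F2 \<noteq> {}" "F3 \<noteq> {}" using p by (auto simp: F vpath_def)
  have sub: "F1 \<subseteq> G" "F2 \<subseteq> G" "F3 \<subseteq> G" unfolding F G using vpath_in[OF _ E] p by blast+
  have d: "F1 \<inter> F2 = {}" "F1 \<inter> F3 = {}" "F2 \<inter> F3 = {}" "F2 \<inter> F1 = {}" "F3 \<inter> F1 = {}" "F3 \<inter> F2 = {}"
    using d by (auto simp: F)
  define h12 h13 h21 h23 h31 h32 where h: "h12 = hits E G F1 F2 F3" "h13 = hits E G F1 F3 F2"
    "h21 = hits E G F2 F1 F3" "h23 = hits E G F2 F3 F1" "h31 = hits E G F3 F1 F2" "h32 = hits E G F3 F2 F1"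
  have "\<not> (h13 \<and> h23)" "\<not> (h12 \<and> h32)" "\<not> (h21 \<and> h31)"
    unfolding h
    using hits_unique[OF vG b(1) b(2) b(3) d(1) d(2) d(3) sub(3) nH]
      hits_unique[OF vG b(1) b(3) b(2) d(2) d(1) d(6) sub(2) nH]
      hits_unique[OF vG b(2) b(3) b(1) d(3) d(4) d(5) sub(1) nH] by simp_all
  moreover have "h13 \<or> h23" "h12 \<or> h32" "h21 \<or> h31"
    unfolding h
    using hits_into[OF strG ne(1) ne(3) sub(1) sub(3) d(2) d(3)]
      hits_into[OF strG ne(1) ne(2) sub(1) sub(2) d(1) d(6)]
      hits_into[OF strG ne(2) ne(1) sub(2) sub(1) d(4) d(5)] by simp_all
  moreover have "h12 \<or> h13" "h21 \<or> h23" "h31 \<or> h32"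
    unfolding h
    using hits_out[OF strG ne(1) ne(2) sub(1) sub(2) d(1) d(2) d(3)]
      hits_out[OF strG ne(2) ne(1) sub(2) sub(1) d(4) d(3) d(2)]
      hits_out[OF strG ne(3) ne(1) sub(3) sub(1) d(5) d(6) d(1)] by simp_all
  ultimately have "(\<not> h13 \<and> \<not> h21 \<and> \<not> h32) \<or> (\<not> h12 \<and> \<not> h31 \<and> \<not> h23)" by argo
  then show False
  proof
    assume n: "\<not> h13 \<and> \<not> h21 \<and> \<not> h32"
    interpret cyc3 E G v F1 F2 F3
      by unfold_locales (use vG strG b sub d nH n h in simp_all)
    show False by (rule not_minimal[OF E v G nc ih])
  next
    assume n: "\<not> h12 \<and> \<not> h31 \<and> \<not> h23"
    interpret cyc3 E G v F1 F3 F2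
      by unfold_locales (use vG strG b sub d nH n h in simp_all)
    show False by (rule not_minimal[OF E v G nc ih])
  qed
qed

theorem H2_bags_exists:
  assumes "finite V" "E \<subseteq> V \<times> V" "irrefl E" "\<not> colorable E"
  shows "\<exists>b. H2_bags E b"
proof -
  have "\<exists>b. b \<noteq> r \<and> H2_bags E b" for r
  proof (rule rooted_induction[where HH = H2_bags, OF _ _ _ _ assms])
    show "H2_bags E b \<Longrightarrow> b \<in> Field E" for E :: "('a \<times> 'a) set" and b
      by (erule H2_bagsE) (rule out_bag_Field)
    show "H2_bags E b \<Longrightarrow> E \<subseteq> E' \<Longrightarrow> H2_bags E' b" for E E' :: "('a \<times> 'a) set" and b
      by (rule H2_bags_mono)
    show "liftable E R v \<Longrightarrow> H2_bags (contract E R v) b \<Longrightarrow> b \<noteq> v \<Longrightarrow> H2_bags E b"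
      for E :: "('a \<times> 'a) set" and R v b by (rule H2_bags_lift)
    fix V :: "'a set" and E v r
    assume *: "E \<subseteq> V \<times> V" "irrefl E" "v \<in> V" "strong E (V - {v})" "\<not> colorable E"
      "\<And>W. W \<subset> V \<Longrightarrow> colorable (Restr E W)"
      "\<And>R. R \<subset> V - {v} \<Longrightarrow> r \<notin> R \<Longrightarrow> liftable E R v \<Longrightarrow> colorable (contract E R v)"
    have "colorable (Restr E (V - {v}))" by (rule *(6)) (use *(3) in blast)
    then obtain p1 p2 p3 where "vpath E v p1" "vpath E v p2" "vpath E v p3"
      "set p1 \<inter> set p2 = {}" "set p1 \<inter> set p3 = {}" "set p2 \<inter> set p3 = {}"
      by (rule three_vpaths[OF *(1,2) _ *(5)])
    then show "H2_bags E v" by (rule H2_core[OF *(1,3,4,5) _ _ _ _ _ _ *(6,7)])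
  qed
  then show ?thesis by blast
qed

subsection \<open>Subdivisions from bags\<close>

lemma cas_trancl:
  assumes "tail G = fst" "head G = snd" "pre_digraph.cas G u p w" "set p \<subseteq> r" "p \<noteq> []"
  shows "(u, w) \<in> r\<^sup>+"
  using assms(3-5)
proof (induction p arbitrary: u)
  case (Cons e p)
  have e: "fst e = u" "pre_digraph.cas G (snd e) p w" "(u, snd e) \<in> r"
    using Cons.prems assms(1,2) by (auto simp: pre_digraph.cas.simps)
  show ?case
  proof (cases "p = []")
    case True
    then show ?thesis using e by (auto simp: pre_digraph.cas.simps)
  next
    case False
    then have "(snd e, w) \<in> r\<^sup>+" using Cons e(2) by simp
    then show ?thesis using e(3) by (rule trancl_into_trancl2[rotated])
  qed
qed simp

text \<open>The shift by \<open>Suc\<close> turns the colours 0, 1, 2 into 1, 2, 3. A cycle inside a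
  colour class would consist of monochromatic arcs.\<close>

lemma colorable_dichromatic:
  assumes "colorable (parcs D)"
  shows "dichromatic_number D \<le> 3"
proof -
  obtain c :: "'a \<Rightarrow> nat" where c: "range c \<subseteq> {..<3}" "acyclic (mono_arcs c (parcs D))"
    using assms by (rule colorableE)
  have "acyclic_coloring D 3 (\<lambda>v. Suc (c v))"
    unfolding acyclic_coloring_def
  proof (intro conjI ballI notI)
    have "c x < 3" for x using c(1) by blast
    then show "(\<lambda>v. Suc (c v)) ` pverts D \<subseteq> {1..3}" by (auto simp: Suc_le_eq)
    fix i :: nat
    let ?G = "with_proj D \<restriction> {v \<in> pverts D. Suc (c v) = i}"
    assume "\<exists>p. pre_digraph.cycle ?G p"
    then obtain u p where p: "pre_digraph.awalk ?G u p u" "p \<noteq> []"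
      unfolding pre_digraph.cycle_def by blast
    have "set p \<subseteq> mono_arcs c (parcs D)"
      using p(1) by (auto simp: pre_digraph.awalk_def mono_arcs_def subset_iff)
    then have "(u, u) \<in> (mono_arcs c (parcs D))\<^sup>+"
      using p by (intro cas_trancl[of ?G]) (auto simp: pre_digraph.awalk_def)
    then show False using c(2) by (simp add: acyclic_def)
  qed
  then show ?thesis unfolding dichromatic_number_def by (intro Least_le) blast
qed

definition arcs_of :: "'a list \<Rightarrow> ('a \<times> 'a) list" where
  "arcs_of xs = zip xs (tl xs)"

lemma arcs_of_Cons: "arcs_of (x # y # ys) = (x, y) # arcs_of (y # ys)" "arcs_of [x] = []"
  by (simp_all add: arcs_of_def)

lemma pcas_arcs_of: "pcas x (arcs_of (x # ys)) (last (x # ys))"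
  by (induction ys arbitrary: x) (auto simp: arcs_of_Cons)

lemma pawalk_verts_arcs_of: "pawalk_verts x (arcs_of (x # ys)) = x # ys"
  by (induction ys arbitrary: x) (auto simp: arcs_of_Cons)

lemma set_arcs_of: "walk E (x # ys) \<Longrightarrow> set (arcs_of (x # ys)) \<subseteq> E"
  by (induction ys arbitrary: x) (auto simp: arcs_of_Cons)

lemma arcs_of_ends: "e \<in> set (arcs_of (x # ys)) \<Longrightarrow> fst e \<in> set (x # ys) \<and> snd e \<in> set (x # ys)"
  by (induction ys arbitrary: x) (auto simp: arcs_of_Cons)

lemma map_fst_arcs_of: "map fst (arcs_of (x # ys)) = butlast (x # ys)"
  by (induction ys arbitrary: x) (auto simp: arcs_of_Cons)

lemma distinct_concat_disjoint:
  assumes "distinct (concat (map g es))" "e \<in> set es" "e' \<in> set es" "e \<noteq> e'"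
  shows "set (g e) \<inter> set (g e') = {}"
  using assms by (induction es) auto

lemma (in pair_wf_digraph) walk_pverts:
  assumes "walk (parcs G) xs" "length xs \<ge> 2"
  shows "set xs \<subseteq> pverts G"
  using assms
proof (induction xs)
  case (Cons x xs)
  then obtain y ys where xs: "xs = y # ys" by (cases xs) auto
  then have "x \<in> pverts G" "y \<in> pverts G" using Cons.prems in_arcsD1 in_arcsD2 by auto
  then show ?case using Cons xs by (cases ys) auto
qed simp

text \<open>\<open>g e\<close> lists the inner vertices of the path for \<open>e\<close>. The single
  condition \<open>d\<close> covers injectivity and all disjointness requirements; since every
  branch vertex is an end of some arc, the walks already place it in \<open>D\<close>.\<close>

lemma contains_subdivisionI:
  fixes D :: "'v pair_pre_digraph" and H :: "'h pair_pre_digraph" and g :: "'h \<times> 'h \<Rightarrow> 'v list"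
  assumes D: "pair_wf_digraph D" and H: "pverts H = set vs" "parcs H = set es" "set es \<subseteq> set vs \<times> set vs"
    and d: "distinct (map f vs @ concat (map g es))"
    and vs: "set vs \<subseteq> fst ` set es \<union> snd ` set es"
    and w: "\<And>u w. (u, w) \<in> set es \<Longrightarrow> u \<noteq> w \<and> walk (parcs D) (f u # g (u, w) @ [f w])"
  shows "contains_subdivision D H"
proof -
  interpret D: pair_wf_digraph D by (rule D)
  define P where "P = (\<lambda>(u, w). arcs_of (f u # g (u, w) @ [f w]))"
  define S where "S = \<lparr>pverts = f ` set vs \<union> (\<Union>e\<in>set es. set (g e)), parcs = (\<Union>e\<in>set es. set (P e))\<rparr>"
  have inner: "pre_digraph.inner_verts (with_proj S) (P e) = g e" for e
    by (cases e) (simp add: inner_verts_with_proj_def P_def map_fst_arcs_of butlast_append)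
  have arcsD: "set (P e) \<subseteq> parcs D" if "e \<in> set es" for e
    using w[of "fst e" "snd e"] that set_arcs_of[of "parcs D" "f (fst e)" "g e @ [f (snd e)]"]
    by (auto simp: P_def split: prod.splits)
  have ends: "fst x \<in> pverts S \<and> snd x \<in> pverts S" if "e \<in> set es" "x \<in> set (P e)" for x e
  proof -
    have "fst x \<in> set (f (fst e) # g e @ [f (snd e)]) \<and> snd x \<in> set (f (fst e) # g e @ [f (snd e)])"
      using that(2) by (intro arcs_of_ends) (simp add: P_def split_beta)
    moreover have "fst e \<in> set vs" "snd e \<in> set vs" using that(1) H(3) by auto
    ultimately show ?thesis using that(1) unfolding S_def by auto
  qed
  have wfS: "pair_wf_digraph S"
  proof
    fix e assume "e \<in> parcs S"
    then obtain e' where "e' \<in> set es" "e \<in> set (P e')" by (auto simp: S_def)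
    then show "fst e \<in> pverts S" "snd e \<in> pverts S" using ends by blast+
  qed
  have wD: "set (f u # g (u, w') @ [f w']) \<subseteq> pverts D" if "(u, w') \<in> set es" for u w'
    using w[OF that] D.walk_pverts[of "f u # g (u, w') @ [f w']"] by simp
  then have gD: "set (g e) \<subseteq> pverts D" if "e \<in> set es" for e
    using that by (cases e) auto
  have fD: "f ` set vs \<subseteq> pverts D"
    using vs wD by fastforce
  have "subgraph (with_proj S) (with_proj D)"
    unfolding subgraph_def
  proof (intro conjI)
    show "verts (with_proj S) \<subseteq> verts (with_proj D)" using fD gD by (simp add: S_def UN_subset_iff)
    show "arcs (with_proj S) \<subseteq> arcs (with_proj D)" using arcsD by (simp add: S_def UN_subset_iff)
    show "wf_digraph (with_proj D)" "wf_digraph (with_proj S)" using D wfS by (simp_all add: wf_digraph_wp_iff)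
  qed auto
  moreover have "subdivision_of H S"
    unfolding subdivision_of_def Let_def
  proof (intro exI[of _ f] exI[of _ P] conjI)
    show "inj_on f (pverts H)" using d H(1) by (simp add: distinct_map)
    show "\<forall>(u, w)\<in>parcs H. pre_digraph.apath (with_proj S) (f u) (P (u, w)) (f w)"
    proof (intro ballI, unfold split_paired_all split)
      fix u w' assume uw: "(u, w') \<in> parcs H"
      then have e: "(u, w') \<in> set es" by (simp add: H)
      have "f u \<in> pverts S" using e H(3) by (auto simp: S_def)
      moreover have "set (P (u, w')) \<subseteq> parcs S" using e by (auto simp: S_def)
      moreover have "pcas (f u) (P (u, w')) (f w')"
        using pcas_arcs_of[of "f u" "g (u, w') @ [f w']"] by (simp add: P_def)
      moreover have "distinct (f u # g (u, w') @ [f w'])"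
      proof -
        have "u \<noteq> w'" "u \<in> set vs" "w' \<in> set vs" using w[OF e] e H(3) by auto
        moreover have "distinct (g (u, w'))" using d e by (auto simp: distinct_concat_iff)
        moreover have "set (g (u, w')) \<inter> f ` set vs = {}" using d e by auto
        ultimately show ?thesis using d by (auto simp: distinct_map inj_on_eq_iff)
      qed
      then have "distinct (pawalk_verts (f u) (P (u, w')))"
        using pawalk_verts_arcs_of[of "f u" "g (u, w') @ [f w']"] by (simp add: P_def)
      ultimately show "pre_digraph.apath (with_proj S) (f u) (P (u, w')) (f w')"
        by (simp add: pre_digraph.apath_def pre_digraph.awalk_def cas_with_proj_eq awalk_verts_with_proj_eq)
    qed
    show "\<forall>e\<in>parcs H. set (pre_digraph.inner_verts (with_proj S) (P e)) \<inter> f ` pverts H = {}"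
      unfolding inner H using d by auto
    show "\<forall>e\<in>parcs H. \<forall>e'\<in>parcs H. e \<noteq> e' \<longrightarrow>
        set (pre_digraph.inner_verts (with_proj S) (P e)) \<inter> set (pre_digraph.inner_verts (with_proj S) (P e')) = {}"
      unfolding inner H using d distinct_concat_disjoint[of g es] by simp
    show "pverts S = f ` pverts H \<union> (\<Union>e\<in>parcs H. set (pre_digraph.inner_verts (with_proj S) (P e)))"
      unfolding inner H by (simp add: S_def)
    show "parcs S = (\<Union>e\<in>parcs H. set (P e))" unfolding H by (simp add: S_def)
  qed
  ultimately show ?thesis unfolding contains_subdivision_def by blast
qed

lemma walk_cons: "(x, hd xs) \<in> E \<Longrightarrow> walk E xs \<Longrightarrow> walk E (x # xs)"
  by (simp add: successively_Cons)

lemma walk_prefix: "walk E (xs @ y # zs) \<Longrightarrow> walk E (xs @ [y])"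
  by (simp add: successively_append_iff)

lemma walk_append: "walk E xs \<Longrightarrow> walk E ys \<Longrightarrow> (last xs, hd ys) \<in> E \<Longrightarrow> walk E (xs @ ys)"
  by (simp add: successively_append_iff)

lemma distinct_bags:
  assumes "distinct X" "distinct Y" "distinct Z" "set X \<subseteq> C" "set Y \<subseteq> A" "set Z \<subseteq> B"
    and "b \<notin> A \<union> C \<union> B" "A \<inter> C = {}" "A \<inter> B = {}" "C \<inter> B = {}"
  shows "distinct (b # X @ Y @ Z)"
proof -
  have "set X \<inter> set Y = {}" "set X \<inter> set Z = {}" "set Y \<inter> set Z = {}" using assms(4-6,8-10) by blast+
  moreover have "b \<notin> set X" "b \<notin> set Y" "b \<notin> set Z" using assms(4-7) by blast+
  ultimately show ?thesis using assms(1-3) by (simp add: Int_Un_distrib)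
qed

lemma H1_subdivision:
  assumes D: "pair_wf_digraph D" and h: "H1_bags (parcs D) b'" and abcd: "distinct [a, b, c, d]"
  shows "contains_subdivision D
    \<lparr>pverts = {a, b, c, d}, parcs = {(a, b), (b, a), (b, c), (c, b), (c, d), (d, a)}\<rparr>"
proof -
  interpret D: pair_wf_digraph D by (rule D)
  define E where "E = parcs D"
  obtain A C B q i j p where *: "b' \<notin> A \<union> C \<union> B" "A \<inter> C = {}" "A \<inter> B = {}" "C \<inter> B = {}"
    "out_bag E b' C q" "(q, i) \<in> E" "reach E B i j" "(j, p) \<in> E" "in_bag E b' A p"
    using h unfolding E_def by (rule H1_bagsE)
  obtain s t where st: "(b', s) \<in> E" "reach E C s t" "(t, b') \<in> E" "reach E C s q"
    using *(5) unfolding out_bag_def by blast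
  obtain ps x ts qs where x: "walk E (ps @ x # ts)" "walk E (x # qs)" "distinct (ps @ x # ts @ qs)"
    "set (ps @ x # ts @ qs) \<subseteq> C" "hd (ps @ [x]) = s" "last (x # ts) = t" "last (x # qs) = q"
    by (rule reach_fork[OF st(2,4)])
  obtain s' t' where st': "(b', s') \<in> E" "reach E A s' t'" "(t', b') \<in> E" "reach E A p t'"
    using *(9) unfolding in_bag_def by blast
  obtain ps' y ts' qs' where y: "walk E (ts' @ y # ps')" "walk E (qs' @ [y])" "distinct (ts' @ y # ps' @ qs')"
    "set (ts' @ y # ps' @ qs') \<subseteq> A" "last (y # ps') = t'" "hd (ts' @ [y]) = s'" "hd (qs' @ [y]) = p"
    by (rule reach_join[OF st'(2,4)])
  obtain ds where ds: "walk E (i # ds)" "distinct (i # ds)" "set (i # ds) \<subseteq> B" "last (i # ds) = j"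
    using reach_walk[OF *(7)] .
  \<comment> \<open>\<open>x\<close> is the fork in \<open>C\<close> and \<open>y\<close> the join
    in \<open>A\<close>. The first vertex \<open>i\<close> of the connecting path plays the role of
    \<open>d\<close>.\<close>
  define f where "f = (\<lambda>v. if v = a then y else if v = b then b' else if v = c then x else i)"
  define g where "g = (\<lambda>e. if e = (a, b) then ps' else if e = (b, a) then ts' else if e = (b, c) then ps
    else if e = (c, b) then ts else if e = (c, d) then qs else ds @ qs')"
  let ?vs = "[a, b, c, d]" and ?es = "[(a, b), (b, a), (b, c), (c, b), (c, d), (d, a)]"
  have fv: "f a = y" "f b = b'" "f c = x" "f d = i" using abcd by (auto simp: f_def)
  have ge: "g (a, b) = ps'" "g (b, a) = ts'" "g (b, c) = ps" "g (c, b) = ts" "g (c, d) = qs" "g (d, a) = ds @ qs'"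
    using abcd by (auto simp: g_def)
  have w: "walk E (y # ps' @ [b'])" "walk E (b' # ts' @ [y])" "walk E (b' # ps @ [x])" "walk E (x # ts @ [b'])"
    "walk E (x # qs @ [i])" "walk E (i # (ds @ qs') @ [y])"
  proof -
    show "walk E (y # ps' @ [b'])" using walk_snoc[OF walk_suffix[OF y(1)]] st' y(5) by simp
    show "walk E (b' # ts' @ [y])" using walk_cons[OF _ walk_prefix[OF y(1)]] st' y(6) by simp
    show "walk E (b' # ps @ [x])" using walk_cons[OF _ walk_prefix[OF x(1)]] st x(5) by simp
    show "walk E (x # ts @ [b'])" using walk_snoc[OF walk_suffix[OF x(1)]] st x(6) by simp
    show "walk E (x # qs @ [i])" using walk_snoc[OF x(2)] *(6) x(7) by simp
    show "walk E (i # (ds @ qs') @ [y])" using walk_append[OF ds(1) y(2)] *(8) ds(4) y(7) by simp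
  qed
  have dist: "distinct (map f ?vs @ concat (map g ?es))"
  proof -
    define X where "X = ps @ x # ts @ qs"
    define Y where "Y = ts' @ y # ps' @ qs'"
    have "distinct X" "distinct Y" "distinct (i # ds)" "set X \<subseteq> C" "set Y \<subseteq> A" "set (i # ds) \<subseteq> B"
      using x(3,4) y(3,4) ds(2,3) unfolding X_def Y_def by blast+
    then have "distinct (b' # X @ Y @ i # ds)"
      by (intro distinct_bags[of X Y "i # ds" C A B b']) (use *(1-4) in blast)+
    \<comment> \<open>Distinctness depends only on the multiset, so the vertices may be regrouped by
      bags.\<close>
    moreover have "mset (map f ?vs @ concat (map g ?es)) = mset (b' # X @ Y @ i # ds)"
      by (simp add: fv ge X_def Y_def)
    ultimately show ?thesis using mset_eq_imp_distinct_iff by blast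
  qed
  show ?thesis
  proof (rule contains_subdivisionI[OF D, where vs = ?vs and es = ?es and f = f and g = g])
    fix u w' assume "(u, w') \<in> set ?es"
    then show "u \<noteq> w' \<and> walk (parcs D) (f u # g (u, w') @ [f w'])"
      using w abcd fv ge unfolding E_def by auto
  qed (use dist in auto)
qed

lemma H2_subdivision:
  assumes D: "pair_wf_digraph D" and h: "H2_bags (parcs D) b'" and abcd: "distinct [a, b, c, d]"
  shows "contains_subdivision D
    \<lparr>pverts = {a, b, c, d}, parcs = {(a, b), (b, a), (b, c), (c, b), (c, d), (a, d)}\<rparr>"
proof -
  interpret D: pair_wf_digraph D by (rule D)
  define E where "E = parcs D"
  obtain A C B q q' i i' z where *: "b' \<notin> A \<union> C \<union> B" "A \<inter> C = {}" "A \<inter> B = {}" "C \<inter> B = {}"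
    "out_bag E b' A q" "(q, i) \<in> E" "reach E B i z" "out_bag E b' C q'" "(q', i') \<in> E" "reach E B i' z"
    using h unfolding E_def by (rule H2_bagsE)
  obtain s t where st: "(b', s) \<in> E" "reach E A s t" "(t, b') \<in> E" "reach E A s q"
    using *(5) unfolding out_bag_def by blast
  obtain ps x ts qs where x: "walk E (ps @ x # ts)" "walk E (x # qs)" "distinct (ps @ x # ts @ qs)"
    "set (ps @ x # ts @ qs) \<subseteq> A" "hd (ps @ [x]) = s" "last (x # ts) = t" "last (x # qs) = q"
    by (rule reach_fork[OF st(2,4)])
  obtain s' t' where st': "(b', s') \<in> E" "reach E C s' t'" "(t', b') \<in> E" "reach E C s' q'"
    using *(8) unfolding out_bag_def by blast
  obtain ps' y ts' qs' where y: "walk E (ps' @ y # ts')" "walk E (y # qs')" "distinct (ps' @ y # ts' @ qs')"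
    "set (ps' @ y # ts' @ qs') \<subseteq> C" "hd (ps' @ [y]) = s'" "last (y # ts') = t'" "last (y # qs') = q'"
    by (rule reach_fork[OF st'(2,4)])
  obtain rs e us ws where e: "walk E (us @ e # rs)" "walk E (ws @ [e])" "distinct (us @ e # rs @ ws)"
    "set (us @ e # rs @ ws) \<subseteq> B" "last (e # rs) = z" "hd (us @ [e]) = i" "hd (ws @ [e]) = i'"
    by (rule reach_join[OF *(7,10)])
  \<comment> \<open>\<open>x\<close> and \<open>y\<close> are the forks in the two bags, and
    \<open>d\<close> is the join \<open>e\<close>, which is where the paths from both bags first
    come together.\<close>
  define f where "f = (\<lambda>v. if v = a then x else if v = b then b' else if v = c then y else e)"
  define g where "g = (\<lambda>e. if e = (a, b) then ts else if e = (b, a) then ps else if e = (b, c) then ps'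
    else if e = (c, b) then ts' else if e = (c, d) then qs' @ ws else qs @ us)"
  let ?vs = "[a, b, c, d]" and ?es = "[(a, b), (b, a), (b, c), (c, b), (c, d), (a, d)]"
  have fv: "f a = x" "f b = b'" "f c = y" "f d = e" using abcd by (auto simp: f_def)
  have ge: "g (a, b) = ts" "g (b, a) = ps" "g (b, c) = ps'" "g (c, b) = ts'" "g (c, d) = qs' @ ws" "g (a, d) = qs @ us"
    using abcd by (auto simp: g_def)
  have w: "walk E (x # ts @ [b'])" "walk E (b' # ps @ [x])" "walk E (b' # ps' @ [y])" "walk E (y # ts' @ [b'])"
    "walk E (y # (qs' @ ws) @ [e])" "walk E (x # (qs @ us) @ [e])"
  proof -
    show "walk E (x # ts @ [b'])" using walk_snoc[OF walk_suffix[OF x(1)]] st x(6) by simp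
    show "walk E (b' # ps @ [x])" using walk_cons[OF _ walk_prefix[OF x(1)]] st x(5) by simp
    show "walk E (b' # ps' @ [y])" using walk_cons[OF _ walk_prefix[OF y(1)]] st' y(5) by simp
    show "walk E (y # ts' @ [b'])" using walk_snoc[OF walk_suffix[OF y(1)]] st' y(6) by simp
    show "walk E (y # (qs' @ ws) @ [e])" using walk_append[OF y(2) e(2)] *(9) y(7) e(7) by simp
    show "walk E (x # (qs @ us) @ [e])" using walk_append[OF x(2) walk_prefix[OF e(1)]] *(6) x(7) e(6) by simp
  qed
  have dist: "distinct (map f ?vs @ concat (map g ?es))"
  proof -
    define X where "X = ps @ x # ts @ qs"
    define Y where "Y = ps' @ y # ts' @ qs'"
    define Z where "Z = us @ e # ws"
    have "distinct Z" "set Z \<subseteq> B" using e(3,4) by (auto simp: Z_def)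
    moreover have "distinct X" "distinct Y" "set X \<subseteq> A" "set Y \<subseteq> C"
      using x(3,4) y(3,4) unfolding X_def Y_def by blast+
    ultimately have "distinct (b' # X @ Y @ Z)"
      by (intro distinct_bags[of X Y Z A C B b']) (use *(1-4) in blast)+
    moreover have "mset (map f ?vs @ concat (map g ?es)) = mset (b' # X @ Y @ Z)"
      by (simp add: fv ge X_def Y_def Z_def)
    ultimately show ?thesis using mset_eq_imp_distinct_iff by blast
  qed
  show ?thesis
  proof (rule contains_subdivisionI[OF D, where vs = ?vs and es = ?es and f = f and g = g])
    fix u w' assume "(u, w') \<in> set ?es"
    then show "u \<noteq> w' \<and> walk (parcs D) (f u # g (u, w') @ [f w'])"
      using w abcd fv ge unfolding E_def by auto
  qed (use dist in auto)
qed

section \<open>The lower bound and the value 4\<close>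

lemma complete3_dichromatic:
  fixes T :: "'v set"
  assumes T: "finite T" "card T = 3"
  defines "D \<equiv> \<lparr>pverts = T, parcs = {(x, y) \<in> T \<times> T. x \<noteq> y}\<rparr>"
  shows "3 \<le> dichromatic_number D"
proof -
  obtain h :: "'v \<Rightarrow> nat" where "bij_betw h T {0..<3}" using ex_bij_betw_finite_nat[OF T(1)] T(2) by auto
  then have h: "inj_on h T" "h ` T = {0..<3}" by (auto simp: bij_betw_def)
  \<comment> \<open>\<open>LEAST\<close> is meaningful only if some colouring exists; an injective
    one has classes without arcs.\<close>
  have "acyclic_coloring D 3 (\<lambda>v. Suc (h v))"
    unfolding acyclic_coloring_def
  proof (intro conjI ballI notI)
    have "h x < 3" if "x \<in> T" for x using h(2) that by (metis atLeastLessThan_iff imageI)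
    then show "(\<lambda>v. Suc (h v)) ` pverts D \<subseteq> {1..3}" by (auto simp: D_def Suc_le_eq)
    fix i :: nat
    let ?G = "with_proj D \<restriction> {v \<in> pverts D. Suc (h v) = i}"
    assume "\<exists>p. pre_digraph.cycle ?G p"
    then obtain u p where p: "pre_digraph.awalk ?G u p u" "p \<noteq> []"
      unfolding pre_digraph.cycle_def by blast
    then have "hd p \<in> arcs ?G" unfolding pre_digraph.awalk_def by (meson hd_in_set subsetD)
    then show False using h(1) by (auto simp: D_def inj_on_def)
  qed
  then have ex: "\<exists>k c. acyclic_coloring D k c" by blast
  have "3 \<le> k" if col: "acyclic_coloring D k c" for k c
  proof (rule ccontr)
    assume "\<not> 3 \<le> k"
    have cT: "c ` T \<subseteq> {1..k}" using col by (simp add: acyclic_coloring_def D_def)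
    then have "card (c ` T) \<le> k" using card_mono[of "{1..k}" "c ` T"] by simp
    then have "\<not> inj_on c T" using T card_image[of c T] \<open>\<not> 3 \<le> k\<close> by auto
    then obtain x y where xy: "x \<in> T" "y \<in> T" "x \<noteq> y" "c x = c y" by (auto simp: inj_on_def)
    let ?G = "with_proj D \<restriction> {v \<in> pverts D. c v = c x}"
    \<comment> \<open>Two vertices of the same colour span a digon, which is a directed cycle of
      length 2.\<close>
    have "pre_digraph.cycle ?G [(x, y), (y, x)]"
      using xy unfolding pre_digraph.cycle_def pre_digraph.awalk_def
      by (intro exI[of _ x]) (auto simp: D_def pre_digraph.cas.simps pre_digraph.awalk_verts.simps)
    moreover have "c x \<in> {1..k}" using cT xy by blast
    ultimately show False using col unfolding acyclic_coloring_def by blast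
  qed
  then show ?thesis unfolding dichromatic_number_def using LeastI_ex[OF ex] by blast
qed

text \<open>The branch vertices of the subdivision embed the vertices of \<open>H\<close> into those
  of \<open>D\<close>.\<close>

lemma contains_subdivision_card:
  fixes D :: "'v pair_pre_digraph" and H :: "'h pair_pre_digraph"
  assumes "contains_subdivision D H" "finite (pverts D)"
  shows "card (pverts H) \<le> card (pverts D)"
proof -
  obtain S where S: "subgraph (with_proj S) (with_proj D)" "subdivision_of H S"
    using assms(1) unfolding contains_subdivision_def by blast
  have SD: "pverts S \<subseteq> pverts D" using S(1) by (simp add: subgraph_def)
  have un: "X = Y \<union> Z \<Longrightarrow> Y \<subseteq> X" for X Y Z :: "'v set" by blast
  have "\<exists>f. inj_on f (pverts H) \<and> f ` pverts H \<subseteq> pverts S"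
    using S(2) unfolding subdivision_of_def Let_def
    by - (elim exE conjE, rule exI, rule conjI, assumption, erule un)
  then obtain f where f: "inj_on f (pverts H)" "f ` pverts H \<subseteq> pverts S" by blast
  have "f ` pverts H \<subseteq> pverts D" using f(2) SD by blast
  then show ?thesis using f(1) assms(2) by (metis card_inj_on_le)
qed

lemma mader_eq_4:
  fixes H :: "'h pair_pre_digraph"
  assumes "card (pverts H) = 4"
    and up: "\<And>D :: ('v :: infinite) pair_pre_digraph. pair_digraph D \<Longrightarrow> \<not> colorable (parcs D) \<Longrightarrow> contains_subdivision D H"
  shows "mader TYPE('v) H = 4"
proof -
  define M where "M = {m. \<forall>D :: 'v pair_pre_digraph. pair_digraph D \<longrightarrow> m \<le> dichromatic_number D \<longrightarrow> contains_subdivision D H}"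
  have "4 \<in> M"
    unfolding M_def
  proof (intro CollectI allI impI)
    fix D :: "'v pair_pre_digraph"
    assume "pair_digraph D" "4 \<le> dichromatic_number D"
    then show "contains_subdivision D H" using up[of D] colorable_dichromatic[of D] by linarith
  qed
  moreover have "4 \<le> m" if m: "m \<in> M" for m
  proof (rule ccontr)
    assume m4: "\<not> 4 \<le> m"
    \<comment> \<open>One vertex fewer than \<open>H\<close> has. An infinite vertex type guarantees
      that such a set exists.\<close>
    obtain T :: "'v set" where T: "finite T" "card T = 3"
      using infinite_arbitrarily_large[OF infinite_UNIV] by blast
    define D where "D = \<lparr>pverts = T, parcs = {(x, y) \<in> T \<times> T. x \<noteq> y}\<rparr>"
    have "pair_digraph D"
      by unfold_locales (use T in \<open>auto simp: D_def intro: finite_subset[of _ "T \<times> T"]\<close>)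
    moreover have "3 \<le> dichromatic_number D"
      unfolding D_def by (rule complete3_dichromatic) fact+
    ultimately have "contains_subdivision D H" using m m4 unfolding M_def by simp
    then have "card (pverts H) \<le> card (pverts D)"
      by (rule contains_subdivision_card) (simp add: D_def T)
    then show False using assms(1) T by (simp add: D_def)
  qed
  ultimately have "(INF m\<in>M. enat m) = enat 4"
    by (intro antisym INF_lower INF_greatest) simp_all
  then show ?thesis unfolding mader_def M_def by (simp add: numeral_eq_enat)
qed

theorem theorem4p1:
  fixes a b c d :: 'h and H1 H2 :: "'h pair_pre_digraph"
  assumes "distinct [a, b, c, d]"
  defines "H1 \<equiv> \<lparr> pverts = {a, b, c, d},
                  parcs = {(a, b), (b, a), (b, c), (c, b), (c, d), (d, a)} \<rparr>"
      and "H2 \<equiv> \<lparr> pverts = {a, b, c, d},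
                  parcs = {(a, b), (b, a), (b, c), (c, b), (c, d), (a, d)} \<rparr>"
  shows "mader TYPE('v :: infinite) H1 = 4 \<and> mader TYPE('v) H2 = 4"
proof -
  have wf: "pair_wf_digraph D" "finite (pverts D)" "parcs D \<subseteq> pverts D \<times> pverts D" "irrefl (parcs D)"
    if "pair_digraph D" for D :: "'v pair_pre_digraph"
  proof -
    interpret pair_digraph D by (rule that)
    show "pair_wf_digraph D" "finite (pverts D)" by (rule pair_wf_digraph, rule pair_finite_verts)
    show "parcs D \<subseteq> pverts D \<times> pverts D" by (auto intro: in_arcsD1 in_arcsD2)
    show "irrefl (parcs D)" unfolding irrefl_def by (metis no_loops')
  qed
  have card: "card {a, b, c, d} = 4" using assms(1) by simp
  have "contains_subdivision D H1" if D: "pair_digraph D" "\<not> colorable (parcs D)" for D :: "'v pair_pre_digraph"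
  proof -
    obtain b' where "H1_bags (parcs D) b'" using H1_bags_exists[OF wf(2-4)[OF D(1)] D(2)] by blast
    then show ?thesis unfolding H1_def by (rule H1_subdivision[OF wf(1)[OF D(1)] _ assms(1)])
  qed
  moreover have "contains_subdivision D H2" if D: "pair_digraph D" "\<not> colorable (parcs D)" for D :: "'v pair_pre_digraph"
  proof -
    obtain b' where "H2_bags (parcs D) b'" using H2_bags_exists[OF wf(2-4)[OF D(1)] D(2)] by blast
    then show ?thesis unfolding H2_def by (rule H2_subdivision[OF wf(1)[OF D(1)] _ assms(1)])
  qed
  moreover have "card (pverts H1) = 4" "card (pverts H2) = 4" using card by (simp_all add: H1_def H2_def)
  ultimately show ?thesis by (intro conjI mader_eq_4)
qed

end
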